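(* Let $A$ be a self-adjoint positive-definite operator in a Hilbert space $\mathbb{H}$ with compact inverse and eigenvalues $0<\lambda_{1}\le\lambda_{2}\le\ldots$ (counted with multiplicity), let $0\le\beta\le\alpha<1$, $\Lambda>0$, and let $j\ge 1$ be such that $\lambda_{j+1}-\lambda_{j}>0$. Put $$\nu_{0} = \frac{\lambda^{\alpha-\beta}_{j+1}}{\lambda^{\alpha-\beta}_{j}+\lambda^{\alpha-\beta}_{j+1}} \, \lambda_{j} + \frac{\lambda^{\alpha-\beta}_{j}}{\lambda^{\alpha-\beta}_{j}+\lambda^{\alpha-\beta}_{j+1}} \, \lambda_{j+1} \in ( \lambda_{j},\lambda_{j+1} ).$$ Then $\sup_{\omega\in\mathbb{R}}\| (A+(-\nu + i \omega)I)^{-1} \|_{\mathbb{H}_{\beta} \to \mathbb{H}_{\alpha}}$, as a function of $\nu\in(\lambda_{j},\lambda_{j+1})$, attains its smallest value at $\nu=\nu_{0}$, and the frequency condition $$\| (A+(-\nu_{0} + i \omega)I)^{-1} \|_{\mathbb{H}_{\beta} \to \mathbb{H}_{\alpha}} < \Lambda^{-1} \quad \text{for all } \omega \in \mathbb{R}$$ holds if and only if the Spectral Gap Condition $$\frac{ \lambda_{j+1} - \lambda_{j} }{\lambda^{\alpha-\beta}_{j} + \lambda^{\alpha-\beta}_{j+1} } > \Lambda$$ holds.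
   Context: For $s\ge 0$, $\mathbb{H}_{s}:=\mathcal{D}(A^{s})$ with norm $|v|_{s}=|A^{s}v|_{\mathbb{H}}$. If $\mathbb{H}$ is real, the resolvent and the spaces are understood in the sense of complexifications. *)

theory Defs
  imports "HOL-Analysis.Analysis"
begin

text \<open>A complex Hilbert space is a type of class real_inner and complete_space together with a complex
  scalar multiplication and a Hermitian inner product (linear in the first argument) that
  extend its real structure, so that the norm of the type is the Hilbert space norm.\<close>

locale complex_inner_product = vector_space scl
  for scl :: "complex \<Rightarrow> 'h::real_inner \<Rightarrow> 'h" +
  fixes ip :: "'h \<Rightarrow> 'h \<Rightarrow> complex"
  assumes scale_of_real: "scl (complex_of_real r) x = r *\<^sub>R x"
    and ip_add_left: "ip (x + y) z = ip x z + ip y z"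
    and ip_scale_left: "ip (scl c x) y = c * ip x y"
    and ip_commute: "ip y x = cnj (ip x y)"
    and inner_eq_Re: "inner x y = Re (ip x y)"

text \<open>The complexification of a real Hilbert space \<^typ>\<open>'r\<close> is \<^typ>\<open>'r \<times> 'r\<close>, where the pair
  \<open>(x, y)\<close> stands for \<open>x + \<i>y\<close>; the library's norm on pairs is the right one.\<close>

definition cplx_scale :: "complex \<Rightarrow> 'r::real_inner \<times> 'r \<Rightarrow> 'r \<times> 'r" where
  "cplx_scale c v = (Re c *\<^sub>R fst v - Im c *\<^sub>R snd v, Re c *\<^sub>R snd v + Im c *\<^sub>R fst v)"

definition cplx_inner :: "'r::real_inner \<times> 'r \<Rightarrow> 'r \<times> 'r \<Rightarrow> complex" where
  "cplx_inner v w = Complex (inner (fst v) (fst w) + inner (snd v) (snd w))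
                            (inner (snd v) (fst w) - inner (fst v) (snd w))"

lemma complex_inner_product_complexification:
  "complex_inner_product (cplx_scale :: complex \<Rightarrow> 'r::real_inner \<times> 'r \<Rightarrow> _) cplx_inner"
  by unfold_locales
    (auto simp: cplx_scale_def cplx_inner_def inner_prod_def complex_eq_iff algebra_simps
        inner_commute)

text \<open>An unbounded operator is a function \<open>A\<close> with a domain \<open>D\<close>; its values outside \<open>D\<close> are irrelevant.
  The definitions below take the scalar multiplication and the inner product as
  parameters, so that they serve real and complex Hilbert spaces alike.\<close>

definition linear_op ::
  "('k::field \<Rightarrow> 'h::real_inner \<Rightarrow> 'h) \<Rightarrow> 'h set \<Rightarrow> ('h \<Rightarrow> 'h) \<Rightarrow> bool" where
  "linear_op scl D A \<longleftrightarrow> module.subspace scl D \<and>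
     (\<forall>u\<in>D. \<forall>v\<in>D. A (u + v) = A u + A v) \<and> (\<forall>c. \<forall>u\<in>D. A (scl c u) = scl c (A u))"

definition adjoint_graph ::
  "('h::real_inner \<Rightarrow> 'h \<Rightarrow> 'k) \<Rightarrow> 'h set \<Rightarrow> ('h \<Rightarrow> 'h) \<Rightarrow> ('h \<times> 'h) set" where
  "adjoint_graph ip D A = {(x, y). \<forall>u\<in>D. ip (A u) x = ip u y}"

definition self_adjoint_op ::
  "('k::field \<Rightarrow> 'h::real_inner \<Rightarrow> 'h) \<Rightarrow> ('h \<Rightarrow> 'h \<Rightarrow> 'k) \<Rightarrow> 'h set \<Rightarrow> ('h \<Rightarrow> 'h) \<Rightarrow> bool" where
  "self_adjoint_op scl ip D A \<longleftrightarrow>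
     linear_op scl D A \<and> closure D = UNIV \<and> adjoint_graph ip D A = {(u, A u) | u. u \<in> D}"

text \<open>In the complex case \<^const>\<open>inner\<close> is the real part of the Hermitian product; this loses
  nothing, as the quadratic form of a self-adjoint operator is real.\<close>

definition positive_definite_op :: "'h::real_inner set \<Rightarrow> ('h \<Rightarrow> 'h) \<Rightarrow> bool" where
  "positive_definite_op D A \<longleftrightarrow> (\<forall>u\<in>D. u \<noteq> 0 \<longrightarrow> inner (A u) u > 0)"

definition compact_inverse_op :: "'h::real_inner set \<Rightarrow> ('h \<Rightarrow> 'h) \<Rightarrow> bool" where
  "compact_inverse_op D A \<longleftrightarrow> bij_betw A D UNIV \<and>
     (\<forall>S. bounded S \<longrightarrow> compact (closure (the_inv_into D A ` S)))"

text \<open>Only real eigenvalues are considered: the operators are self-adjoint.\<close>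

definition eigenspace :: "'h::real_inner set \<Rightarrow> ('h \<Rightarrow> 'h) \<Rightarrow> real \<Rightarrow> 'h set" where
  "eigenspace D A \<mu> = {u \<in> D. A u = \<mu> *\<^sub>R u}"

definition eigenvalues :: "'h::real_inner set \<Rightarrow> ('h \<Rightarrow> 'h) \<Rightarrow> real set" where
  "eigenvalues D A = {\<mu>. \<exists>u\<in>eigenspace D A \<mu>. u \<noteq> 0}"

text \<open>The eigenvalues \<open>lam n\<close>, \<open>n \<in> I\<close>, in nondecreasing order and counted with multiplicity. The
  index set is all of \<open>{1..}\<close> in infinite dimension and \<open>{1..N}\<close> in dimension \<open>N\<close>.\<close>

definition eigenvalue_enumeration ::
  "('k::field \<Rightarrow> 'h::real_inner \<Rightarrow> 'h) \<Rightarrow> 'h set \<Rightarrow> ('h \<Rightarrow> 'h) \<Rightarrow> nat set \<Rightarrow> (nat \<Rightarrow> real) \<Rightarrow> bool"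
  where
  "eigenvalue_enumeration scl D A I lam \<longleftrightarrow>
     (I = {1..} \<or> (\<exists>N. I = {1..N})) \<and> (\<forall>n\<in>I. 0 < lam n) \<and> mono_on I lam \<and>
     (\<forall>\<mu>. finite {n\<in>I. lam n = \<mu>} \<and>
          card {n\<in>I. lam n = \<mu>} = vector_space.dim scl (eigenspace D A \<mu>))"

definition orth_proj ::
  "('h::real_inner \<Rightarrow> 'h \<Rightarrow> 'k::zero) \<Rightarrow> 'h set \<Rightarrow> 'h \<Rightarrow> 'h" where
  "orth_proj ip S v = (THE p. p \<in> S \<and> (\<forall>u\<in>S. ip (v - p) u = 0))"

text \<open>The power \<open>A\<^sup>s\<close> and its domain, given by the functional calculus of a positive self-adjoint
  operator with discrete spectrum: \<open>A\<^sup>s v\<close> is the sum of \<open>\<mu>\<^sup>s P\<^sub>\<mu> v\<close> over the eigenvalues \<open>\<mu>\<close>, where \<open>P\<^sub>\<mu>\<close>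
  is the orthogonal projection onto the eigenspace.\<close>

definition pow_dom ::
  "('h::real_inner \<Rightarrow> 'h \<Rightarrow> 'k::zero) \<Rightarrow> 'h set \<Rightarrow> ('h \<Rightarrow> 'h) \<Rightarrow> real \<Rightarrow> 'h set" where
  "pow_dom ip D A s =
     {v. (\<lambda>\<mu>. \<mu> powr (2 * s) * (norm (orth_proj ip (eigenspace D A \<mu>) v))\<^sup>2)
           summable_on eigenvalues D A}"

definition pow_op ::
  "('h::real_inner \<Rightarrow> 'h \<Rightarrow> 'k::zero) \<Rightarrow> 'h set \<Rightarrow> ('h \<Rightarrow> 'h) \<Rightarrow> real \<Rightarrow> 'h \<Rightarrow> 'h" where
  "pow_op ip D A s v =
     (\<Sum>\<^sub>\<infinity>\<mu>\<in>eigenvalues D A. \<mu> powr s *\<^sub>R orth_proj ip (eigenspace D A \<mu>) v)"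

definition pow_norm ::
  "('h::real_inner \<Rightarrow> 'h \<Rightarrow> 'k::zero) \<Rightarrow> 'h set \<Rightarrow> ('h \<Rightarrow> 'h) \<Rightarrow> real \<Rightarrow> 'h \<Rightarrow> real" where
  "pow_norm ip D A s v = norm (pow_op ip D A s v)"

definition resolvent ::
  "(complex \<Rightarrow> 'h::real_inner \<Rightarrow> 'h) \<Rightarrow> 'h set \<Rightarrow> ('h \<Rightarrow> 'h) \<Rightarrow> complex \<Rightarrow> 'h \<Rightarrow> 'h" where
  "resolvent scl D A z = the_inv_into D (\<lambda>u. A u + scl z u)"

text \<open>The norm of \<open>T\<close> as an operator from the space \<open>X\<close> with norm \<open>nX\<close> to the space \<open>Y\<close> with norm \<open>nY\<close>;
  it is \<open>\<infinity>\<close> if \<open>T\<close> is unbounded or does not map \<open>X\<close> into \<open>Y\<close>.\<close>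

definition opnorm_between ::
  "'a set \<Rightarrow> ('a \<Rightarrow> real) \<Rightarrow> 'b set \<Rightarrow> ('b \<Rightarrow> real) \<Rightarrow> ('a \<Rightarrow> 'b) \<Rightarrow> ennreal" where
  "opnorm_between X nX Y nY T =
     Inf (ennreal ` {C. 0 \<le> C \<and> (\<forall>v\<in>X. T v \<in> Y \<and> nY (T v) \<le> C * nX v)})"

text \<open>The norm of \<open>(A + z I)\<^sup>-\<^sup>1\<close> from \<open>D(A\<^sup>b)\<close> to \<open>D(A\<^sup>a)\<close>.\<close>

definition resolvent_norm ::
  "(complex \<Rightarrow> 'h::real_inner \<Rightarrow> 'h) \<Rightarrow> ('h \<Rightarrow> 'h \<Rightarrow> complex) \<Rightarrow> 'h set \<Rightarrow> ('h \<Rightarrow> 'h) \<Rightarrow>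
     real \<Rightarrow> real \<Rightarrow> complex \<Rightarrow> ennreal" where
  "resolvent_norm scl ip D A b a z =
     opnorm_between (pow_dom ip D A b) (pow_norm ip D A b)
       (pow_dom ip D A a) (pow_norm ip D A a) (resolvent scl D A z)"

end

theory Submission
  imports Defs
begin

text \<open>Both cases reduce to a real Hilbert space with the inner product \<open>Re ip\<close>: projections onto complex
  subspaces and self-adjointness do not change under this passage. Since the eigenvectors of
  \<open>A\<close> are complete, the resolvent acts on the eigenspace of \<open>\<mu>\<close> as division by \<open>\<mu> + z\<close>, so its norm from
  \<open>D(A\<^sup>\<beta>)\<close> to \<open>D(A\<^sup>\<alpha>)\<close> is the supremum of \<open>\<mu>\<^sup>g / \<bar>\<mu> + z\<bar>\<close> over the eigenvalues, where \<open>g = \<alpha> - \<beta>\<close>. For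
  \<open>z = - \<nu> + \<i> \<omega>\<close> it is largest at \<open>\<omega> = 0\<close>, and there only the neighbours \<open>lo < \<nu> < hi\<close> of \<open>\<nu>\<close> matter. The
  values at these two neighbours agree at \<open>\<nu>\<^sub>0\<close>, with common value \<open>M = (lo\<^sup>g + hi\<^sup>g) / (hi - lo)\<close>; for any
  other \<open>\<nu>\<close> one of them exceeds \<open>M\<close>.\<close>

section \<open>Orthogonal projections and finite-dimensional subspaces\<close>

text \<open>Gram-Schmidt: the part \<open>q\<close> of the new vector \<open>b\<close> orthogonal to
  \<open>span B\<close> is the only new direction, so it suffices to add to \<open>p\<close> the
  component of \<open>v - p\<close> along \<open>q\<close>.\<close>

lemma finite_span_projection:
  fixes v :: "'a::real_inner"
  assumes "finite B"
  shows "\<exists>p\<in>span B. \<forall>u\<in>span B. inner (v - p) u = 0"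
  using assms
proof (induction B arbitrary: v rule: finite_induct)
  case empty
  then show ?case by simp
next
  case (insert b B)
  obtain p where p: "p \<in> span B" "\<And>u. u \<in> span B \<Longrightarrow> inner (v - p) u = 0"
    using insert.IH by blast
  obtain r where r: "r \<in> span B" "\<And>u. u \<in> span B \<Longrightarrow> inner (b - r) u = 0"
    using insert.IH by blast
  define q where "q = b - r"
  \<comment> \<open>If \<open>b\<close> already lies in \<open>span B\<close>, then
    \<open>q = 0\<close> and division by zero gives \<open>t = 0\<close>; the identity
    \<open>t * inner q q = inner (v - p) q\<close> holds in that case too.\<close>
  define t where "t = inner (v - p) q / inner q q"
  have B_sub: "span B \<subseteq> span (insert b B)"
    by (rule span_mono) auto
  have q_in: "q \<in> span (insert b B)"
    unfolding q_def using r(1) B_sub by (intro span_diff span_base[of b]) auto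
  have t: "t * inner q q = inner (v - p) q"
    by (auto simp: t_def)
  have "inner (v - (p + t *\<^sub>R q)) u = 0" if u: "u \<in> span (insert b B)" for u
  proof -
    obtain k where k: "u - k *\<^sub>R b \<in> span B"
      using u by (auto simp: span_insert)
    define w where "w = (u - k *\<^sub>R b) + k *\<^sub>R r"
    have w: "w \<in> span B"
      unfolding w_def using k r(1) by (intro span_add span_scale) auto
    have u_eq: "u = w + k *\<^sub>R q"
      by (simp add: w_def q_def algebra_simps)
    have "inner (v - p) w = 0" "inner q w = 0"
      using p(2)[OF w] r(2)[OF w] by (auto simp: q_def)
    then show ?thesis
      using t by (simp add: u_eq inner_diff_left inner_add_left inner_add_right)
  qed
  moreover have "p + t *\<^sub>R q \<in> span (insert b B)"
    using p(1) B_sub q_in by (auto intro!: span_add span_scale)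
  ultimately show ?case by blast
qed

text \<open>Riesz: a unit vector orthogonal to a finite net of the unit ball would be far from the net.\<close>
lemma subspace_finitely_spanned:
  fixes E :: "'a::real_inner set"
  assumes E: "subspace E" and compact: "compact (closure (E \<inter> cball 0 1))"
  obtains B where "finite B" "B \<subseteq> E" "E = span B"
proof -
  let ?S = "E \<inter> cball 0 1"
  have "closure ?S \<subseteq> (\<Union>x\<in>?S. ball x (1/2))"
  proof
    fix y assume "y \<in> closure ?S"
    then obtain x where "x \<in> ?S" "dist x y < 1/2"
      using closure_approachable[of y ?S] by (metis half_gt_zero zero_less_one)
    then show "y \<in> (\<Union>x\<in>?S. ball x (1/2))" by auto
  qed
  with compact obtain B where B: "B \<subseteq> ?S" "finite B" "closure ?S \<subseteq> (\<Union>x\<in>B. ball x (1/2))"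
    by - (rule compactE_image[of "closure ?S" ?S "\<lambda>x. ball x (1/2)"], auto)
  have "E \<subseteq> span B"
  proof
    fix e assume e: "e \<in> E"
    obtain p where p: "p \<in> span B" "\<And>u. u \<in> span B \<Longrightarrow> inner (e - p) u = 0"
      using finite_span_projection[OF \<open>finite B\<close>] by blast
    have span_sub: "span B \<subseteq> E"
      using B(1) E by (intro span_minimal) auto
    show "e \<in> span B"
    proof (rule ccontr)
      assume "e \<notin> span B"
      then have ne: "e - p \<noteq> 0" using p(1) by auto
      define q where "q = (1 / norm (e - p)) *\<^sub>R (e - p)"
      have "q \<in> E"
        unfolding q_def using e p(1) span_sub E by (auto intro!: subspace_scale subspace_diff)
      moreover have norm_q: "norm q = 1" using ne by (simp add: q_def)
      ultimately have "q \<in> closure ?S" using closure_subset[of ?S] by auto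
      then obtain x where x: "x \<in> B" "dist x q < 1/2" using B(3) by auto
      have "inner q x = 0"
        using p(2)[OF span_base[OF x(1)]] by (simp add: q_def)
      then have "(norm (x - q))\<^sup>2 = (norm x)\<^sup>2 + 1"
        using norm_q by (simp add: power2_norm_eq_inner inner_diff_left inner_diff_right
            inner_commute norm_eq_1)
      moreover have "(norm (x - q))\<^sup>2 < 1\<^sup>2"
        using x(2) by (intro power_strict_mono) (auto simp: dist_norm)
      ultimately show False by (smt (verit) one_power2 zero_le_power2)
    qed
  qed
  with B that show ?thesis
    by (metis E Int_subset_iff span_minimal subset_antisym)
qed

text \<open>The difference of two candidates lies in \<open>S\<close> and is orthogonal to itself,
  so the definite description in \<open>orth_proj\<close> has at most one witness.\<close>

lemma orth_proj_eqI:
  fixes p :: "'a::real_inner"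
  assumes S: "subspace S" and p: "p \<in> S" "\<And>u. u \<in> S \<Longrightarrow> inner (v - p) u = 0"
  shows "orth_proj inner S v = p"
  unfolding orth_proj_def
proof (rule the_equality)
  fix q assume q: "q \<in> S \<and> (\<forall>u\<in>S. inner (v - q) u = 0)"
  then have "q - p \<in> S" using S p(1) by (auto intro: subspace_diff)
  then have "inner (v - p) (q - p) = 0" "inner (v - q) (q - p) = 0"
    using p(2) q by auto
  then have "inner (q - p) (q - p) = 0"
    by (simp add: inner_diff_left)
  then show "q = p" by simp
qed (use p in auto)

section \<open>Orthogonal series in a Hilbert space\<close>

text \<open>Pythagoras holds for finite partial sums and passes to the limit by continuity of the
  norm.\<close>

lemma has_sum_power2_norm:
  fixes f :: "'i \<Rightarrow> 'a::real_inner"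
  assumes orth: "pairwise (\<lambda>i j. orthogonal (f i) (f j)) X" and f: "(f has_sum s) X"
  shows "((\<lambda>i. (norm (f i))\<^sup>2) has_sum (norm s)\<^sup>2) X"
proof -
  have "((\<lambda>F. (norm (sum f F))\<^sup>2) \<longlongrightarrow> (norm s)\<^sup>2) (finite_subsets_at_top X)"
    using f unfolding has_sum_def by (intro tendsto_intros)
  moreover have "\<forall>\<^sub>F F in finite_subsets_at_top X.
      (norm (sum f F))\<^sup>2 = (\<Sum>i\<in>F. (norm (f i))\<^sup>2)"
    by (rule eventually_finite_subsets_at_top_weakI)
       (auto intro!: norm_sum_Pythagorean pairwise_subset[OF orth])
  ultimately show ?thesis
    unfolding has_sum_def by (rule Lim_transform_eventually)
qed

text \<open>By Pythagoras, enlarging a finite partial sum changes it by a vector whose squared norm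
  is the increment of the sum of squared norms. Hence the partial sums are Cauchy, and completeness
  provides the limit.\<close>

lemma orthogonal_summable_on:
  fixes f :: "'i \<Rightarrow> 'a::{real_inner,complete_space}"
  assumes orth: "pairwise (\<lambda>i j. orthogonal (f i) (f j)) X"
    and summable: "(\<lambda>i. (norm (f i))\<^sup>2) summable_on X"
  shows "f summable_on X"
proof -
  let ?g = "\<lambda>i. (norm (f i))\<^sup>2"
  have "\<exists>P. eventually P (finite_subsets_at_top X) \<and>
              (\<forall>F F'. P F \<and> P F' \<longrightarrow> dist (sum f F) (sum f F') < e)" if "e > 0" for e
  proof -
    \<comment> \<open>Sums of squares within \<open>d/2\<close> of their limit differ by less than
      \<open>d\<close>; its root \<open>e/2\<close> is the distance allowed between
      \<open>sum f F\<close> and \<open>sum f F0\<close>.\<close>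
    define d where "d = (e/2)\<^sup>2"
    have d: "d > 0" using that by (simp add: d_def)
    have "(sum ?g \<longlongrightarrow> infsum ?g X) (finite_subsets_at_top X)"
      using summable has_sum_infsum has_sum_def by blast
    then have "\<forall>\<^sub>F F in finite_subsets_at_top X. dist (sum ?g F) (infsum ?g X) < d/2"
      by (rule tendstoD) (use d in simp)
    then obtain F0 where F0: "finite F0" "F0 \<subseteq> X"
      "\<And>F. finite F \<Longrightarrow> F0 \<subseteq> F \<Longrightarrow> F \<subseteq> X \<Longrightarrow> dist (sum ?g F) (infsum ?g X) < d/2"
      unfolding eventually_finite_subsets_at_top by metis
    define P where "P F \<longleftrightarrow> finite F \<and> F0 \<subseteq> F \<and> F \<subseteq> X" for F
    have "eventually P (finite_subsets_at_top X)"
      unfolding eventually_finite_subsets_at_top P_def using F0 by blast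
    moreover have near: "dist (sum f F) (sum f F0) < e/2" if F: "P F" for F
    proof -
      have "(norm (sum f (F - F0)))\<^sup>2 = sum ?g (F - F0)"
        using F orth by (intro norm_sum_Pythagorean) (auto simp: P_def intro: pairwise_subset)
      also have "\<dots> = sum ?g F - sum ?g F0"
        using F F0 by (subst sum_diff) (auto simp: P_def)
      also have "\<dots> < d"
        using F0(3)[of F] F0(3)[of F0] F F0(1,2) unfolding P_def dist_real_def
        by (smt (verit) field_sum_of_halves order_refl)
      finally have "norm (sum f (F - F0)) < e/2"
        unfolding d_def by (rule power_less_imp_less_base) (use \<open>e > 0\<close> in simp)
      moreover have "sum f (F - F0) = sum f F - sum f F0"
        using F F0 by (subst sum_diff) (auto simp: P_def)
      ultimately show ?thesis by (simp add: dist_norm)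
    qed
    have "dist (sum f F) (sum f F') < e" if "P F" "P F'" for F F'
      using near[OF that(1)] near[OF that(2)] dist_triangle2[of "sum f F" "sum f F'" "sum f F0"]
      by linarith
    ultimately show ?thesis by blast
  qed
  then have "cauchy_filter (filtermap (sum f) (finite_subsets_at_top X))"
    by (simp add: cauchy_filter_metric_filtermap)
  moreover have "complete (UNIV::'a set)"
    by (meson Cauchy_convergent UNIV_I complete_def convergent_def)
  ultimately obtain L where "(sum f \<longlongrightarrow> L) (finite_subsets_at_top X)"
    using complete_uniform[where S=UNIV] by (force simp add: filterlim_def)
  then show ?thesis
    using summable_on_def has_sum_def by blast
qed

lemma powr_double: "x powr (2 * s) = (x powr s)\<^sup>2" for x s :: real
  by (simp add: powr_add[symmetric] power2_eq_square)

lemma has_sum_inner: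
  assumes "(f has_sum s) X"
  shows "((\<lambda>i. inner x (f i)) has_sum inner x s) X"
  using has_sum_bounded_linear[OF bounded_linear_inner_right assms] by simp

section \<open>Eigenspaces of the operator and the spectral theorem\<close>

text \<open>The setting over the real scalars. The condition \<open>graph\<close> says that
  \<open>A\<close> equals its adjoint as a relation; one inclusion is symmetry, the other is
  maximality of the domain.\<close>

locale positive_discrete_operator =
  fixes D :: "'h::{real_inner,complete_space} set" and A :: "'h \<Rightarrow> 'h"
  assumes linear: "linear_op scaleR D A"
    and graph: "adjoint_graph inner D A = {(u, A u) | u. u \<in> D}"
    and positive: "positive_definite_op D A"
    and compact_inverse: "compact_inverse_op D A"
begin

abbreviation "E \<equiv> eigenspace D A"
abbreviation "\<sigma> \<equiv> eigenvalues D A"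
abbreviation "P \<mu> \<equiv> orth_proj inner (E \<mu>)"

lemma subspace_D: "subspace D"
  and A_add: "u \<in> D \<Longrightarrow> v \<in> D \<Longrightarrow> A (u + v) = A u + A v"
  and A_scale: "u \<in> D \<Longrightarrow> A (c *\<^sub>R u) = c *\<^sub>R A u"
  using linear by (auto simp: linear_op_def subspace_raw_def)

lemma A_symmetric: "u \<in> D \<Longrightarrow> v \<in> D \<Longrightarrow> inner (A u) v = inner u (A v)"
  using graph by (auto simp: adjoint_graph_def set_eq_iff)

text \<open>A vector that solves the equation weakly, against all of \<open>D\<close>, lies in the
  domain and solves it. Limits and series are shown to belong to \<open>D\<close> in this
  way.\<close>

lemma A_maximal:
  assumes "\<And>u. u \<in> D \<Longrightarrow> inner (A u) x = inner u y"
  shows "x \<in> D" "A x = y"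
proof -
  have "(x, y) \<in> adjoint_graph inner D A"
    using assms by (simp add: adjoint_graph_def)
  then show "x \<in> D" "A x = y" unfolding graph by auto
qed

lemma eigenvector: "u \<in> E \<mu> \<Longrightarrow> u \<in> D" "u \<in> E \<mu> \<Longrightarrow> A u = \<mu> *\<^sub>R u"
  by (auto simp: eigenspace_def)

lemma A_0: "A 0 = 0"
  using A_scale[of 0 0] subspace_0[OF subspace_D] by simp

lemma subspace_eigenspace: "subspace (E \<mu>)"
  using subspace_D A_0 A_add A_scale
  by (auto simp: subspace_def eigenspace_def algebra_simps)

lemma eigenvalue_pos: "\<mu> \<in> \<sigma> \<Longrightarrow> \<mu> > 0"
proof -
  assume "\<mu> \<in> \<sigma>"
  then obtain u where u: "u \<in> E \<mu>" "u \<noteq> 0" by (auto simp: eigenvalues_def)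
  then have "inner (\<mu> *\<^sub>R u) u > 0"
    using positive eigenvector[OF u(1)] by (metis positive_definite_op_def)
  moreover have "inner u u > 0" using u(2) by simp
  ultimately show ?thesis by (auto simp: zero_less_mult_iff)
qed

lemma eigenspace_orthogonal:
  assumes "u \<in> E \<mu>" "v \<in> E \<mu>'" "\<mu> \<noteq> \<mu>'"
  shows "inner u v = 0"
  using A_symmetric[of u v] assms by (auto simp: eigenspace_def)

lemma inverse_compact: "bounded S \<Longrightarrow> compact (closure (the_inv_into D A ` S))"
  and A_bij: "bij_betw A D UNIV"
  using compact_inverse by (auto simp: compact_inverse_op_def)

lemma inverse_in_D: "the_inv_into D A x \<in> D" and A_inverse: "A (the_inv_into D A x) = x"
  and inverse_A: "u \<in> D \<Longrightarrow> the_inv_into D A (A u) = u"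
proof -
  show "the_inv_into D A x \<in> D"
    using A_bij by (metis UNIV_I bij_betw_def order_refl the_inv_into_into)
  show "A (the_inv_into D A x) = x"
    using A_bij f_the_inv_into_f_bij_betw by fastforce
  show "u \<in> D \<Longrightarrow> the_inv_into D A (A u) = u"
    using A_bij by (auto simp: bij_betw_def the_inv_into_f_f)
qed

text \<open>For \<open>\<mu> \<noteq> 0\<close> the inverse of \<open>A\<close> acts on
  \<open>E \<mu>\<close> as division by \<open>\<mu>\<close>, so the unit ball of
  \<open>E \<mu>\<close> is a multiple of its own image under a compact map. For
  \<open>\<mu> = 0\<close> positivity makes the eigenspace trivial.\<close>

lemma eigenspace_finitely_spanned:
  obtains B where "finite B" "B \<subseteq> E \<mu>" "E \<mu> = span B"
proof (rule subspace_finitely_spanned[OF subspace_eigenspace])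
  let ?S = "E \<mu> \<inter> cball 0 1"
  have "?S = (\<lambda>x. \<mu> *\<^sub>R x) ` the_inv_into D A ` ?S" if "\<mu> \<noteq> 0"
  proof -
    have "\<mu> *\<^sub>R the_inv_into D A x = x" if x: "x \<in> ?S" for x
    proof -
      have "A ((1 / \<mu>) *\<^sub>R x) = x"
        using x \<open>\<mu> \<noteq> 0\<close> A_scale[of x "1 / \<mu>"] by (auto simp: eigenspace_def)
      then have "the_inv_into D A x = (1 / \<mu>) *\<^sub>R x"
        using inverse_A[of "(1 / \<mu>) *\<^sub>R x"] x eigenvector(1) subspace_scale[OF subspace_D] by auto
      then show ?thesis using \<open>\<mu> \<noteq> 0\<close> by simp
    qed
    then show ?thesis by (auto simp: image_image)
  qed
  moreover have "?S \<subseteq> {0}" if "\<mu> = 0"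
    using eigenvalue_pos[of 0] that by (auto simp: eigenvalues_def)
  moreover have "compact (closure ((\<lambda>x. \<mu> *\<^sub>R x) ` the_inv_into D A ` ?S))"
    using compact_scaling[OF inverse_compact[of ?S], of \<mu>]
    by (simp add: closure_scaleR[symmetric] bounded_Int)
  ultimately show "compact (closure ?S)"
    by (metis closure_insert closure_empty compact_empty compact_insert subset_singleton_iff)
qed (use that in auto)

text \<open>Finite dimension of \<open>E \<mu>\<close> gives existence of the projection, so the
  description behind \<open>P \<mu>\<close> is meaningful.\<close>

lemma proj_in: "P \<mu> v \<in> E \<mu>" and proj_orthogonal: "u \<in> E \<mu> \<Longrightarrow> inner (v - P \<mu> v) u = 0"
proof -
  obtain B where B: "finite B" "E \<mu> = span B" by (rule eigenspace_finitely_spanned)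
  obtain p where "p \<in> E \<mu>" "\<And>u. u \<in> E \<mu> \<Longrightarrow> inner (v - p) u = 0"
    using finite_span_projection[OF B(1)] B(2) by metis
  moreover from this have "P \<mu> v = p"
    by (intro orth_proj_eqI subspace_eigenspace)
  ultimately show "P \<mu> v \<in> E \<mu>" "u \<in> E \<mu> \<Longrightarrow> inner (v - P \<mu> v) u = 0" by auto
qed

lemma eigenvectors_pairwise_orthogonal:
  assumes "\<And>\<mu>. \<mu> \<in> X \<Longrightarrow> f \<mu> \<in> E \<mu>"
  shows "pairwise (\<lambda>\<mu> \<mu>'. orthogonal (f \<mu>) (f \<mu>')) X"
  unfolding pairwise_def orthogonal_def using assms eigenspace_orthogonal by blast

text \<open>Pairing the series with a vector of \<open>E \<mu>\<close> leaves only the term at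
  \<open>\<mu>\<close>, because distinct eigenspaces are orthogonal.\<close>

lemma proj_eigensum:
  assumes f: "\<And>\<mu>. \<mu> \<in> \<sigma> \<Longrightarrow> f \<mu> \<in> E \<mu>" "(f has_sum w) \<sigma>" and \<mu>: "\<mu> \<in> \<sigma>"
  shows "P \<mu> w = f \<mu>"
proof (rule orth_proj_eqI[OF subspace_eigenspace f(1)[OF \<mu>]])
  fix u assume u: "u \<in> E \<mu>"
  have "((\<lambda>\<mu>'. inner u (f \<mu>')) has_sum inner u (f \<mu>)) \<sigma>"
    by (rule has_sum_finite_neutralI[of "{\<mu>}"])
       (use \<mu> u f(1) in \<open>auto intro: eigenspace_orthogonal\<close>)
  then have "inner u w = inner u (f \<mu>)"
    using has_sum_inner[OF f(2)] has_sum_unique by blast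
  then show "inner (w - f \<mu>) u = 0"
    by (simp add: inner_diff_right inner_commute[of _ u])
qed

text \<open>A maximizing sequence for the form of \<open>A\<^sup>-\<^sup>1\<close> on the unit ball of \<open>W\<close> would yield an eigenvector
  of \<open>A\<close> in \<open>W\<close>.\<close>
lemma eigenvectors_complement_trivial:
  assumes W: "\<And>v. v \<in> W \<longleftrightarrow> (\<forall>\<mu>\<in>\<sigma>. \<forall>e\<in>E \<mu>. inner v e = 0)"
  shows "W \<subseteq> {0}"
proof (rule ccontr)
  let ?K = "the_inv_into D A"
  assume "\<not> W \<subseteq> {0}"
  then obtain x0 where x0: "x0 \<in> W" "x0 \<noteq> 0" by auto
  have W_sub: "subspace W"
    by (auto simp: subspace_def W inner_add_left)
  have K_sym: "inner (?K x) y = inner x (?K y)" for x y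
    using A_symmetric[OF inverse_in_D inverse_in_D] A_inverse by metis
  have K_add: "?K (x + y) = ?K x + ?K y" for x y
    by (metis A_add A_inverse inverse_A inverse_in_D subspace_D subspace_add)
  have K_scale: "?K (c *\<^sub>R x) = c *\<^sub>R ?K x" for c x
    by (metis A_scale A_inverse inverse_A inverse_in_D subspace_D subspace_scale)
  have K_pos: "inner (?K x) x > 0" if "x \<noteq> 0" for x
  proof -
    have "?K x \<noteq> 0"
      using A_inverse[of x] A_0 that by force
    then show ?thesis
      using positive inverse_in_D A_inverse by (metis inner_commute positive_definite_op_def)
  qed
  have K_nonneg: "inner (?K x) x \<ge> 0" for x
    using K_pos[of x] by (cases "x = 0") (auto intro: less_imp_le)
  \<comment> \<open>Symmetry moves \<open>A\<close> onto the eigenvector: \<open>inner x e\<close>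
    is \<open>\<mu>\<close> times \<open>inner (?K x) e\<close>, so \<open>?K\<close> preserves
    \<open>W\<close>.\<close>
  have K_W: "?K x \<in> W" if x: "x \<in> W" for x
    unfolding W
  proof (intro ballI)
    fix \<mu> e assume e: "\<mu> \<in> \<sigma>" "e \<in> E \<mu>"
    have "0 = inner x e" using x e by (auto simp: W)
    also have "\<dots> = inner (?K x) (A e)"
      using A_symmetric[OF inverse_in_D, of e x] e(2) eigenvector(1) A_inverse by auto
    finally show "inner (?K x) e = 0"
      using eigenvalue_pos[OF e(1)] eigenvector(2)[OF e(2)] by simp
  qed
  define Q where "Q = (\<lambda>x. inner (?K x) x) ` (W \<inter> cball 0 1)"
  have "bounded (?K ` (W \<inter> cball 0 1))"
    using inverse_compact[of "W \<inter> cball 0 1"] compact_imp_bounded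
    by (metis bounded_Int bounded_cball bounded_subset closure_subset)
  then obtain C where C: "\<And>x. x \<in> W \<inter> cball 0 1 \<Longrightarrow> norm (?K x) \<le> C"
    unfolding bounded_iff by blast
  have Q_le: "inner (?K x) x \<le> C" if x: "x \<in> W \<inter> cball 0 1" for x
  proof -
    have "inner (?K x) x \<le> norm (?K x) * norm x" by (rule norm_cauchy_schwarz)
    also have "\<dots> \<le> norm (?K x) * 1" using x by (intro mult_left_mono) auto
    finally show ?thesis using C[OF x] by simp
  qed
  have Q_bdd: "bdd_above Q" unfolding Q_def using Q_le by (rule bdd_aboveI2)
  \<comment> \<open>This supremum will turn out to be an eigenvalue of \<open>?K\<close> with an
    eigenvector in the closure of the range of \<open>?K\<close> on \<open>W\<close>; the matching
    eigenvalue of \<open>A\<close> is \<open>1 / m\<close>.\<close>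
  define m where "m = Sup Q"
  have Q_ne: "Q \<noteq> {}" using subspace_0[OF W_sub] by (auto simp: Q_def)
  have m_upper: "inner (?K x) x \<le> m" if "x \<in> W" "norm x \<le> 1" for x
    unfolding m_def using Q_bdd that by (intro cSup_upper) (auto simp: Q_def)
  have m_pos: "m > 0"
  proof -
    let ?x = "(1 / norm x0) *\<^sub>R x0"
    have "inner (?K ?x) ?x > 0" using x0 by (intro K_pos) auto
    moreover have "inner (?K ?x) ?x \<le> m"
      using x0 W_sub by (intro m_upper subspace_scale) auto
    ultimately show ?thesis by linarith
  qed
  have m_form: "inner (?K x) x \<le> m * (norm x)\<^sup>2" if x: "x \<in> W" for x
  proof (cases "x = 0")
    case False
    let ?x = "(1 / norm x) *\<^sub>R x"
    have "inner (?K ?x) ?x \<le> m"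
      using x False W_sub by (intro m_upper subspace_scale) auto
    then show ?thesis using False by (simp add: K_scale field_simps power2_eq_square)
  qed auto
  \<comment> \<open>Cauchy--Schwarz for the form of \<open>K\<close>, applied to \<open>x\<close> and \<open>K x\<close>\<close>
  have K_bound: "(norm (?K x))\<^sup>2 \<le> m * inner (?K x) x" if x: "x \<in> W" for x
  proof -
    let ?y = "?K x" and ?t = "1 / m"
    have "0 \<le> inner (?K (x + (- ?t) *\<^sub>R ?y)) (x + (- ?t) *\<^sub>R ?y)" by (rule K_nonneg)
    also have "\<dots> = inner ?y x - 2 * ?t * inner ?y ?y + ?t\<^sup>2 * inner (?K ?y) ?y"
      unfolding K_add K_scale
      by (simp add: K_sym[of ?y x] power2_eq_square algebra_simps)
    also have "\<dots> \<le> inner ?y x - 2 * ?t * inner ?y ?y + ?t\<^sup>2 * (m * (norm ?y)\<^sup>2)"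
      using m_form[OF K_W[OF x]] by (intro add_left_mono mult_left_mono) auto
    also have "\<dots> = inner ?y x - ?t * (norm ?y)\<^sup>2"
      using m_pos by (simp add: power2_norm_eq_inner[symmetric] field_simps power2_eq_square)
    finally show ?thesis using m_pos by (simp add: field_simps)
  qed
  have "\<exists>x\<in>W \<inter> cball 0 1. inner (?K x) x > m - 1 / real (Suc n)" for n
  proof -
    have "m - 1 / real (Suc n) < Sup Q" by (simp add: m_def)
    then show ?thesis using less_cSup_iff[OF Q_ne Q_bdd] by (auto simp: Q_def)
  qed
  then obtain x where x: "\<And>n. x n \<in> W \<inter> cball 0 1"
    "\<And>n. inner (?K (x n)) (x n) > m - 1 / real (Suc n)"
    by metis
  have lim_form: "(\<lambda>n. inner (?K (x n)) (x n)) \<longlonglongrightarrow> m"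
  proof (rule tendsto_sandwich[where h = "\<lambda>_. m"])
    show "(\<lambda>n. m - 1 / real (Suc n)) \<longlonglongrightarrow> m"
      using tendsto_diff[OF tendsto_const LIMSEQ_inverse_real_of_nat, of m]
      by (simp add: inverse_eq_divide)
  qed (use x m_upper in \<open>auto intro!: always_eventually less_imp_le\<close>)
  \<comment> \<open>Compactness gives convergence of the images \<open>?K (x (r n))\<close> only;
    convergence of \<open>x (r n)\<close> itself follows from the next estimate.\<close>
  obtain y r where r: "strict_mono r" and y: "(\<lambda>n. ?K (x (r n))) \<longlonglongrightarrow> y"
  proof -
    have "seq_compact (closure (?K ` (W \<inter> cball 0 1)))"
      by (intro compact_imp_seq_compact inverse_compact) (simp add: bounded_Int)
    moreover have "\<forall>n. ?K (x n) \<in> closure (?K ` (W \<inter> cball 0 1))"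
      using x(1) closure_subset by blast
    ultimately obtain l r where "strict_mono r" "((\<lambda>n. ?K (x n)) \<circ> r) \<longlonglongrightarrow> l"
      by (rule seq_compactE)
    then show ?thesis using that by (simp add: o_def)
  qed
  \<comment> \<open>Expanding the square and using \<open>K_bound\<close> and
    \<open>norm (x n) \<le> 1\<close> shows that a maximizing sequence consists of approximate
    eigenvectors for \<open>m\<close>.\<close>
  have diff_bound: "(norm (?K (x n) - m *\<^sub>R x n))\<^sup>2 \<le> m * (m - inner (?K (x n)) (x n))" for n
  proof -
    have "(norm (?K (x n) - m *\<^sub>R x n))\<^sup>2
        = (norm (?K (x n)))\<^sup>2 - 2 * m * inner (?K (x n)) (x n) + m\<^sup>2 * (norm (x n))\<^sup>2"
      unfolding power2_norm_eq_inner
      by (simp add: inner_commute power2_eq_square algebra_simps)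
    also have "\<dots> \<le> m * inner (?K (x n)) (x n) - 2 * m * inner (?K (x n)) (x n) + m\<^sup>2 * 1"
      using K_bound[of "x n"] x(1)[of n]
      by (intro add_mono diff_right_mono mult_left_mono) (auto simp: power_le_one)
    finally show ?thesis by (simp add: algebra_simps power2_eq_square)
  qed
  have "(\<lambda>n. (norm (?K (x n) - m *\<^sub>R x n))\<^sup>2) \<longlonglongrightarrow> 0"
  proof (rule tendsto_sandwich[where f = "\<lambda>_. 0"])
    show "(\<lambda>n. m * (m - inner (?K (x n)) (x n))) \<longlonglongrightarrow> 0"
      using tendsto_mult[OF tendsto_const tendsto_diff[OF tendsto_const lim_form], of m m] by simp
  qed (use diff_bound in \<open>auto intro!: always_eventually\<close>)
  then have "(\<lambda>n. sqrt ((norm (?K (x n) - m *\<^sub>R x n))\<^sup>2)) \<longlonglongrightarrow> sqrt 0"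
    by (rule tendsto_real_sqrt)
  then have "(\<lambda>n. ?K (x n) - m *\<^sub>R x n) \<longlonglongrightarrow> 0"
    by (simp add: tendsto_norm_zero_iff)
  then have "(\<lambda>n. ?K (x (r n)) - m *\<^sub>R x (r n)) \<longlonglongrightarrow> 0"
    using LIMSEQ_subseq_LIMSEQ[OF _ r] by (simp add: o_def)
  from tendsto_diff[OF y this] have "(\<lambda>n. (1 / m) *\<^sub>R (m *\<^sub>R x (r n))) \<longlonglongrightarrow> (1 / m) *\<^sub>R y"
    by (intro tendsto_intros) simp
  then have xr: "(\<lambda>n. x (r n)) \<longlonglongrightarrow> (1 / m) *\<^sub>R y"
    using m_pos by simp
  \<comment> \<open>The eigenvalue equation is first passed to the limit in weak form, with
    \<open>A\<close> acting on the fixed vector \<open>u\<close>; \<open>A_maximal\<close> then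
    places \<open>y\<close> in \<open>D\<close>.\<close>
  have y_eig: "inner (A u) y = inner u ((1 / m) *\<^sub>R y)" if u: "u \<in> D" for u
  proof (rule LIMSEQ_unique)
    show "(\<lambda>n. inner (A u) (?K (x (r n)))) \<longlonglongrightarrow> inner (A u) y"
      using y by (intro tendsto_intros)
    have "inner (A u) (?K (x (r n))) = inner u (x (r n))" for n
      using A_symmetric[OF u inverse_in_D] A_inverse by simp
    then show "(\<lambda>n. inner (A u) (?K (x (r n)))) \<longlonglongrightarrow> inner u ((1 / m) *\<^sub>R y)"
      using tendsto_inner[OF tendsto_const xr, of u] by simp
  qed
  have y_E: "y \<in> E (1 / m)"
    using A_maximal[OF y_eig] by (simp add: eigenspace_def)
  \<comment> \<open>The form at the limit equals \<open>m > 0\<close>, which rules out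
    \<open>y = 0\<close>.\<close>
  have y_form: "(\<lambda>n. inner (?K (x (r n))) (x (r n))) \<longlonglongrightarrow> inner y ((1 / m) *\<^sub>R y)"
    using y xr by (intro tendsto_intros)
  moreover have "(\<lambda>n. inner (?K (x (r n))) (x (r n))) \<longlonglongrightarrow> m"
    using LIMSEQ_subseq_LIMSEQ[OF lim_form r] by (simp add: o_def)
  ultimately have "inner y ((1 / m) *\<^sub>R y) = m"
    by (rule LIMSEQ_unique)
  then have y0: "y \<noteq> 0" using m_pos by auto
  then have \<sigma>: "1 / m \<in> \<sigma>" using y_E by (auto simp: eigenvalues_def)
  \<comment> \<open>As an eigenvector, \<open>y\<close> is orthogonal to all of \<open>W\<close>; as
    a limit of vectors of \<open>W\<close>, it is then orthogonal to itself.\<close>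
  have "inner (?K (x (r n))) y = 0" for n
    using K_W[of "x (r n)"] x(1) \<sigma> y_E by (auto simp: W)
  moreover have "(\<lambda>n. inner (?K (x (r n))) y) \<longlonglongrightarrow> inner y y"
    using y by (intro tendsto_intros)
  ultimately have "inner y y = 0"
    by (simp add: LIMSEQ_const_iff)
  then show False using y0 by simp
qed

lemma eigenvectors_complete:
  assumes "\<And>\<mu> e. \<mu> \<in> \<sigma> \<Longrightarrow> e \<in> E \<mu> \<Longrightarrow> inner v e = 0"
  shows "v = 0"
  using eigenvectors_complement_trivial[of "{v. \<forall>\<mu>\<in>\<sigma>. \<forall>e\<in>E \<mu>. inner v e = 0}"] assms by auto

text \<open>Bessel's inequality makes the projections summable to some \<open>s\<close>. Since
  \<open>v\<close> and \<open>s\<close> have the same projections, \<open>v - s\<close> is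
  orthogonal to every eigenvector and vanishes by completeness.\<close>

theorem spectral_expansion: "((\<lambda>\<mu>. P \<mu> v) has_sum v) \<sigma>"
proof -
  have orth: "pairwise (\<lambda>\<mu> \<mu>'. orthogonal (P \<mu> v) (P \<mu>' v)) X" for X
    by (rule eigenvectors_pairwise_orthogonal) (rule proj_in)
  have bessel: "(\<Sum>\<mu>\<in>F. (norm (P \<mu> v))\<^sup>2) \<le> (norm v)\<^sup>2" if "finite F" for F
  proof -
    let ?s = "\<Sum>\<mu>\<in>F. P \<mu> v"
    have norm_s: "(norm ?s)\<^sup>2 = (\<Sum>\<mu>\<in>F. (norm (P \<mu> v))\<^sup>2)"
      using that orth by (rule norm_sum_Pythagorean)
    have "inner v (P \<mu> v) = (norm (P \<mu> v))\<^sup>2" for \<mu>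
      using proj_orthogonal[OF proj_in, of v \<mu> v] by (simp add: inner_diff_left power2_norm_eq_inner)
    then have "inner v ?s = (norm ?s)\<^sup>2"
      by (simp add: inner_sum_right norm_s)
    moreover have "0 \<le> (norm (v - ?s))\<^sup>2" by simp
    ultimately show ?thesis
      unfolding norm_s[symmetric]
      by (simp add: power2_norm_eq_inner inner_diff_left inner_diff_right inner_commute)
  qed
  have "(\<lambda>\<mu>. (norm (P \<mu> v))\<^sup>2) summable_on \<sigma>"
    by (rule nonneg_bdd_above_summable_on) (use bessel in \<open>auto intro!: bdd_aboveI2\<close>)
  then obtain s where s: "((\<lambda>\<mu>. P \<mu> v) has_sum s) \<sigma>"
    using orthogonal_summable_on[OF orth] by (auto simp: summable_on_def)
  have "v - s = 0"
  proof (rule eigenvectors_complete)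
    fix \<mu> e assume e: "\<mu> \<in> \<sigma>" "e \<in> E \<mu>"
    have "P \<mu> s = P \<mu> v"
      by (rule proj_eigensum[OF _ s e(1)]) (rule proj_in)
    then show "inner (v - s) e = 0"
      using proj_orthogonal[OF e(2), of v] proj_orthogonal[OF e(2), of s]
      by (simp add: inner_diff_left)
  qed
  with s show ?thesis by simp
qed

section \<open>Norms of the fractional power spaces\<close>

text \<open>Parseval for the series of \<open>pow_op\<close>. As \<open>infsum\<close> is 0 for a
  series that does not converge, membership in \<open>pow_dom\<close> is first turned into
  convergence.\<close>

lemma pow_norm_sq:
  assumes v: "v \<in> pow_dom inner D A s"
  shows "((\<lambda>\<mu>. \<mu> powr (2 * s) * (norm (P \<mu> v))\<^sup>2) has_sum (pow_norm inner D A s v)\<^sup>2) \<sigma>"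
proof -
  let ?f = "\<lambda>\<mu>. \<mu> powr s *\<^sub>R P \<mu> v"
  have norm_f: "(norm (?f \<mu>))\<^sup>2 = \<mu> powr (2 * s) * (norm (P \<mu> v))\<^sup>2" for \<mu>
    by (simp add: power_mult_distrib powr_double)
  have orth: "pairwise (\<lambda>\<mu> \<mu>'. orthogonal (?f \<mu>) (?f \<mu>')) \<sigma>"
    by (intro eigenvectors_pairwise_orthogonal subspace_scale[OF subspace_eigenspace] proj_in)
  have "(\<lambda>\<mu>. (norm (?f \<mu>))\<^sup>2) summable_on \<sigma>"
    unfolding norm_f using v by (simp add: pow_dom_def)
  then have "(?f has_sum pow_op inner D A s v) \<sigma>"
    unfolding pow_op_def using orthogonal_summable_on[OF orth] by simp
  from has_sum_power2_norm[OF orth this] show ?thesis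
    unfolding norm_f pow_norm_def .
qed

lemma proj_eigenvector:
  assumes "e \<in> E \<mu>" "\<mu> \<in> \<sigma>" "\<mu>' \<in> \<sigma>"
  shows "P \<mu>' e = (if \<mu>' = \<mu> then e else 0)"
proof (rule proj_eigensum[OF _ _ assms(3)])
  show "((\<lambda>\<mu>'. if \<mu>' = \<mu> then e else 0) has_sum e) \<sigma>"
    by (rule has_sum_finite_neutralI[of "{\<mu>}"]) (use assms in auto)
qed (use assms subspace_0[OF subspace_eigenspace] in auto)

text \<open>Eigenvectors later serve as test vectors for the lower bound on the resolvent
  norm.\<close>

lemma pow_eigenvector:
  assumes "e \<in> E \<mu>" "\<mu> \<in> \<sigma>"
  shows "e \<in> pow_dom inner D A s" "pow_norm inner D A s e = \<mu> powr s * norm e"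
proof -
  have "((\<lambda>\<mu>'. \<mu>' powr (2 * s) * (norm (P \<mu>' e))\<^sup>2) has_sum \<mu> powr (2 * s) * (norm e)\<^sup>2) \<sigma>"
    by (rule has_sum_finite_neutralI[of "{\<mu>}"]) (use assms proj_eigenvector[OF assms] in auto)
  then show "e \<in> pow_dom inner D A s"
    by (auto simp: pow_dom_def summable_on_def)
  have "((\<lambda>\<mu>'. \<mu>' powr s *\<^sub>R P \<mu>' e) has_sum \<mu> powr s *\<^sub>R e) \<sigma>"
    by (rule has_sum_finite_neutralI[of "{\<mu>}"]) (use assms proj_eigenvector[OF assms] in auto)
  then show "pow_norm inner D A s e = \<mu> powr s * norm e"
    by (simp add: pow_norm_def pow_op_def infsumI)
qed

end

section \<open>Passage from the Hermitian to the real inner product\<close>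

context complex_inner_product
begin

lemma ip_scale_right: "ip x (scl c y) = cnj c * ip x y"
  by (metis complex_cnj_mult ip_commute ip_scale_left)

lemma inner_scl: "inner (scl c x) y = inner x (scl (cnj c) y)"
  by (simp add: inner_eq_Re ip_scale_left ip_scale_right)

lemma norm_scl: "norm (scl c x) = cmod c * norm x"
proof -
  have "inner (scl c x) (scl c x) = inner x (scl (complex_of_real ((cmod c)\<^sup>2)) x)"
    by (simp only: inner_scl scale_scale complex_norm_square mult.commute)
  also have "\<dots> = (cmod c)\<^sup>2 * inner x x"
    by (simp only: scale_of_real inner_scaleR_right)
  finally show ?thesis
    by (simp add: norm_eq_sqrt_inner real_sqrt_mult)
qed

lemma scl_scaleR: "scl c (r *\<^sub>R x) = r *\<^sub>R scl c x"
  by (metis mult.commute scale_of_real scale_scale)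

lemma bounded_linear_scl: "bounded_linear (scl c)"
  by (rule bounded_linear_intro[of _ "cmod c"])
     (auto simp: scale_right_distrib scl_scaleR norm_scl mult.commute)

text \<open>Since \<open>ip\<close> is conjugate linear in its second argument, multiplying that
  argument by \<open>\<i>\<close> brings the imaginary part into the real part.\<close>

lemma ip_eq_Complex: "ip x y = Complex (inner x y) (inner x (scl \<i> y))"
  by (simp add: complex_eq_iff inner_eq_Re ip_scale_right)

text \<open>If \<open>S\<close> is closed under \<open>\<i>\<close>, real orthogonality to
  \<open>S\<close> already forces the imaginary parts to vanish.\<close>

lemma orth_proj_inner:
  assumes "\<And>u. u \<in> S \<Longrightarrow> scl \<i> u \<in> S"
  shows "orth_proj ip S = orth_proj inner S"
  unfolding orth_proj_def ip_eq_Complex using assms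
  by (intro ext arg_cong[of _ _ The]) (auto simp: complex_eq_iff)

text \<open>Testing the real equation with \<open>scl (- \<i>) u\<close> in place of
  \<open>u\<close> gives equality of the imaginary parts.\<close>

lemma adjoint_graph_inner:
  assumes "linear_op scl D A"
  shows "adjoint_graph ip D A = adjoint_graph inner D A"
proof -
  have "ip (A u) x = ip u y"
    if xy: "\<forall>u\<in>D. inner (A u) x = inner u y" and u: "u \<in> D" for x y u
  proof -
    have D: "scl (- \<i>) u \<in> D" "A (scl (- \<i>) u) = scl (- \<i>) (A u)"
      using assms u subspace_scale[of D u "- \<i>"] unfolding linear_op_def by blast+
    then have "inner (A u) (scl \<i> x) = inner u (scl \<i> y)"
      using bspec[OF xy D(1)] by (simp add: inner_scl)
    then show ?thesis using xy u by (simp add: ip_eq_Complex)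
  qed
  then show ?thesis
    by (auto simp: adjoint_graph_def inner_eq_Re)
qed

lemma linear_op_scaleR:
  assumes "linear_op scl D A"
  shows "linear_op scaleR D A"
  using assms unfolding linear_op_def subspace_raw_def[symmetric] real_vector.subspace_def
  by (auto simp: subspace_def simp flip: scale_of_real)

end

section \<open>The resolvent as a spectral multiplier\<close>

locale complex_positive_discrete_operator =
  positive_discrete_operator D A + complex_inner_product scl ip
  for D :: "'h::{real_inner,complete_space} set" and A :: "'h \<Rightarrow> 'h"
    and scl :: "complex \<Rightarrow> 'h \<Rightarrow> 'h" and ip :: "'h \<Rightarrow> 'h \<Rightarrow> complex" +
  assumes complex_linear: "linear_op scl D A"
begin

lemma scl_D: "u \<in> D \<Longrightarrow> scl c u \<in> D" and A_scl: "u \<in> D \<Longrightarrow> A (scl c u) = scl c (A u)"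
  using complex_linear by (auto simp: linear_op_def subspace_def)

lemma scl_eigenspace: "u \<in> E \<mu> \<Longrightarrow> scl c u \<in> E \<mu>"
  using scl_D A_scl by (auto simp: eigenspace_def scl_scaleR)

lemma orth_proj_eigenspace: "orth_proj ip (E \<mu>) = P \<mu>"
  by (rule orth_proj_inner) (rule scl_eigenspace)

lemma pow_dom_inner: "pow_dom ip D A s = pow_dom inner D A s"
  and pow_norm_inner: "pow_norm ip D A s = pow_norm inner D A s"
  by (auto simp: pow_dom_def pow_norm_def pow_op_def orth_proj_eigenspace)

lemma shifted_eigenvector: "u \<in> E \<mu> \<Longrightarrow> A u + scl z u = scl (of_real \<mu> + z) u"
  by (simp add: eigenspace_def scale_left_distrib scale_of_real)

text \<open>The resolvent is a \<open>the_inv_into\<close>, so a solution is its value once the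
  shifted operator is injective. A vector in the kernel is orthogonal to every eigenvector, hence
  zero.\<close>

lemma resolvent_eqI:
  assumes z: "\<And>\<mu>. \<mu> \<in> \<sigma> \<Longrightarrow> of_real \<mu> + z \<noteq> 0" and w: "w \<in> D" "A w + scl z w = v"
  shows "resolvent scl D A z v = w"
proof -
  have "inj_on (\<lambda>u. A u + scl z u) D"
  proof (rule inj_onI)
    fix x y assume xy: "x \<in> D" "y \<in> D" "A x + scl z x = A y + scl z y"
    define u where "u = x - y"
    have uD: "u \<in> D" using xy subspace_D by (auto simp: u_def intro: real_vector.subspace_diff)
    have "A x = A (u + y)" by (simp add: u_def)
    also have "\<dots> = A u + A y" using uD xy by (intro A_add)
    finally have u0: "A u + scl z u = 0"
      using xy(3) by (simp add: u_def scale_right_diff_distrib algebra_simps)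
    have "u = 0"
    proof (rule eigenvectors_complete)
      fix \<mu> e assume e: "\<mu> \<in> \<sigma>" "e \<in> E \<mu>"
      \<comment> \<open>Chosen so that the adjoint shift \<open>A + cnj z\<close> maps
        \<open>e'\<close> to \<open>e\<close>.\<close>
      define e' where "e' = scl (1 / (of_real \<mu> + cnj z)) e"
      have ne: "of_real \<mu> + cnj z \<noteq> 0"
        using z[OF e(1)] by (metis complex_cnj_add complex_cnj_cnj complex_cnj_complex_of_real complex_cnj_zero)
      have e': "e' \<in> E \<mu>" unfolding e'_def using e(2) by (rule scl_eigenspace)
      have "0 = inner (A u + scl z u) e'" by (simp add: u0)
      also have "\<dots> = inner u (A e' + scl (cnj z) e')"
        using uD eigenvector(1)[OF e']
        by (simp add: inner_add_left inner_add_right A_symmetric inner_scl)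
      also have "\<dots> = inner u e"
        unfolding shifted_eigenvector[OF e'] using ne by (simp add: e'_def)
      finally show "inner u e = 0" by simp
    qed
    then show "x = y" by (simp add: u_def)
  qed
  then show ?thesis
    unfolding resolvent_def using w by (intro the_inv_into_f_eq)
qed

text \<open>The distance \<open>c\<close> bounds the multipliers, so the series converges. Its sum
  solves the resolvent equation weakly, and \<open>A_maximal\<close> turns this into a solution in
  \<open>D\<close>.\<close>

lemma resolvent_expansion:
  assumes c: "c > 0" "\<And>\<mu>. \<mu> \<in> \<sigma> \<Longrightarrow> c \<le> cmod (of_real \<mu> + z)"
  shows "((\<lambda>\<mu>. scl (1 / (of_real \<mu> + z)) (P \<mu> v)) has_sum resolvent scl D A z v) \<sigma>"
proof -
  let ?f = "\<lambda>\<mu>. scl (1 / (of_real \<mu> + z)) (P \<mu> v)"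
  have f_E: "?f \<mu> \<in> E \<mu>" for \<mu> by (intro scl_eigenspace proj_in)
  have ne: "of_real \<mu> + z \<noteq> 0" if "\<mu> \<in> \<sigma>" for \<mu> using c that by force
  have norm_sum: "((\<lambda>\<mu>. (norm (P \<mu> v))\<^sup>2) has_sum (norm v)\<^sup>2) \<sigma>"
    by (intro has_sum_power2_norm eigenvectors_pairwise_orthogonal proj_in spectral_expansion)
  have "(\<lambda>\<mu>. (norm (?f \<mu>))\<^sup>2) summable_on \<sigma>"
  proof (rule summable_on_comparison_test)
    show "(\<lambda>\<mu>. (1 / c)\<^sup>2 * (norm (P \<mu> v))\<^sup>2) summable_on \<sigma>"
      using norm_sum by (intro summable_on_cmult_right) (rule has_sum_imp_summable)
    fix \<mu> assume "\<mu> \<in> \<sigma>"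
    then show "(norm (?f \<mu>))\<^sup>2 \<le> (1 / c)\<^sup>2 * (norm (P \<mu> v))\<^sup>2"
      using c(1) c(2)[of \<mu>] unfolding norm_scl norm_divide power_mult_distrib
      by (intro mult_right_mono power_mono) (auto simp: frac_le)
  qed auto
  then obtain w where w: "(?f has_sum w) \<sigma>"
    using orthogonal_summable_on[OF eigenvectors_pairwise_orthogonal[OF f_E]]
    by (auto simp: summable_on_def)
  \<comment> \<open>\<open>A\<close> cannot be applied to the series term by term, being unbounded.
    Each term is paired with \<open>A u\<close> instead, and symmetry is used termwise.\<close>
  have weak: "inner (A u) w = inner u (v - scl z w)" if u: "u \<in> D" for u
  proof -
    have "((\<lambda>\<mu>. P \<mu> v + scl (- z) (?f \<mu>)) has_sum v + scl (- z) w) \<sigma>"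
      by (intro has_sum_add spectral_expansion
          has_sum_bounded_linear[OF bounded_linear_scl, unfolded o_def] w)
    then have rhs: "((\<lambda>\<mu>. inner u (P \<mu> v + scl (- z) (?f \<mu>))) has_sum inner u (v + scl (- z) w)) \<sigma>"
      by (rule has_sum_inner)
    have "inner (A u) (?f \<mu>) = inner u (P \<mu> v + scl (- z) (?f \<mu>))" if \<mu>: "\<mu> \<in> \<sigma>" for \<mu>
    proof -
      have "scl (of_real \<mu> + z) (?f \<mu>) = P \<mu> v" using ne[OF \<mu>] by simp
      then have "A (?f \<mu>) + scl z (?f \<mu>) = P \<mu> v"
        using shifted_eigenvector[OF f_E, of \<mu> z] by simp
      then have "A (?f \<mu>) = P \<mu> v + scl (- z) (?f \<mu>)"
        by (metis add_diff_cancel_right' diff_conv_add_uminus scale_minus_left)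
      then show ?thesis
        using A_symmetric[OF u eigenvector(1)[OF f_E]] by simp
    qed
    then have "((\<lambda>\<mu>. inner (A u) (?f \<mu>)) has_sum inner u (v + scl (- z) w)) \<sigma>"
      using rhs by (simp cong: has_sum_cong)
    then have "inner (A u) w = inner u (v + scl (- z) w)"
      by (rule has_sum_unique[OF has_sum_inner[OF w]])
    then show ?thesis by simp
  qed
  have "resolvent scl D A z v = w"
    using A_maximal[OF weak] by (intro resolvent_eqI ne) auto
  with w show ?thesis by simp
qed

text \<open>Coefficients are compared in each eigenspace and summed by Parseval: \<open>c\<close>
  secures the expansion of the resolvent, while \<open>M\<close> bounds the multiplier between the
  weighted norms.\<close>

lemma resolvent_norm_le:
  assumes c: "c > 0" "\<And>\<mu>. \<mu> \<in> \<sigma> \<Longrightarrow> c \<le> cmod (of_real \<mu> + z)"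
    and M: "M \<ge> 0" "\<And>\<mu>. \<mu> \<in> \<sigma> \<Longrightarrow> \<mu> powr (a - b) \<le> M * cmod (of_real \<mu> + z)"
  shows "resolvent_norm scl ip D A b a z \<le> ennreal M"
proof -
  have "resolvent scl D A z v \<in> pow_dom inner D A a \<and>
        pow_norm inner D A a (resolvent scl D A z v) \<le> M * pow_norm inner D A b v"
    if v: "v \<in> pow_dom inner D A b" for v
  proof -
    let ?w = "resolvent scl D A z v"
    note sum_v = has_sum_cmult_right[OF pow_norm_sq[OF v], of "M\<^sup>2"]
    have termwise: "\<mu> powr (2 * a) * (norm (P \<mu> ?w))\<^sup>2
        \<le> M\<^sup>2 * (\<mu> powr (2 * b) * (norm (P \<mu> v))\<^sup>2)" if \<mu>: "\<mu> \<in> \<sigma>" for \<mu>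
    proof -
      let ?d = "cmod (of_real \<mu> + z)"
      have d: "?d > 0" using c \<mu> by fastforce
      have "\<mu> powr a = \<mu> powr (a - b) * \<mu> powr b"
        by (simp add: powr_add[symmetric])
      also have "\<dots> \<le> (M * ?d) * \<mu> powr b"
        using M(2)[OF \<mu>] by (intro mult_right_mono) auto
      finally have le: "\<mu> powr a / ?d \<le> M * \<mu> powr b"
        using d by (simp add: field_simps)
      have "P \<mu> ?w = scl (1 / (of_real \<mu> + z)) (P \<mu> v)"
        by (rule proj_eigensum[OF _ resolvent_expansion[OF c] \<mu>])
           (intro scl_eigenspace proj_in)
      then have "\<mu> powr (2 * a) * (norm (P \<mu> ?w))\<^sup>2 = (\<mu> powr a / ?d * norm (P \<mu> v))\<^sup>2"
        by (simp add: norm_scl norm_divide power_mult_distrib power_divide powr_double)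
      also have "\<dots> \<le> (M * \<mu> powr b * norm (P \<mu> v))\<^sup>2"
        using le by (intro power_mono mult_right_mono) auto
      also have "\<dots> = M\<^sup>2 * (\<mu> powr (2 * b) * (norm (P \<mu> v))\<^sup>2)"
        by (simp add: power_mult_distrib powr_double)
      finally show ?thesis .
    qed
    have w: "?w \<in> pow_dom inner D A a"
      unfolding pow_dom_def using summable_on_comparison_test[OF has_sum_imp_summable[OF sum_v] termwise]
      by auto
    have "(pow_norm inner D A a ?w)\<^sup>2 \<le> M\<^sup>2 * (pow_norm inner D A b v)\<^sup>2"
      by (rule has_sum_mono[OF pow_norm_sq[OF w] sum_v termwise])
    then have "(pow_norm inner D A a ?w)\<^sup>2 \<le> (M * pow_norm inner D A b v)\<^sup>2"
      by (simp add: power_mult_distrib)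
    then have "pow_norm inner D A a ?w \<le> M * pow_norm inner D A b v"
      by (rule power2_le_imp_le) (use M(1) in \<open>simp add: pow_norm_def\<close>)
    with w show ?thesis by simp
  qed
  then show ?thesis
    unfolding resolvent_norm_def opnorm_between_def pow_dom_inner pow_norm_inner
    using M(1) by (intro Inf_lower) auto
qed

text \<open>On an eigenvector for \<open>\<mu>\<close> the ratio of the two norms is exactly the
  multiplier, so every admissible constant \<open>C\<close> is at least as large.\<close>

lemma resolvent_norm_ge:
  assumes z: "\<And>\<mu>. \<mu> \<in> \<sigma> \<Longrightarrow> of_real \<mu> + z \<noteq> 0" and \<mu>: "\<mu> \<in> \<sigma>"
  shows "ennreal (\<mu> powr (a - b) / cmod (of_real \<mu> + z)) \<le> resolvent_norm scl ip D A b a z"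
  unfolding resolvent_norm_def opnorm_between_def pow_dom_inner pow_norm_inner
proof (rule Inf_greatest, clarify, rule ennreal_leI)
  fix C :: real
  assume C: "\<forall>v\<in>pow_dom inner D A b. resolvent scl D A z v \<in> pow_dom inner D A a \<and>
    pow_norm inner D A a (resolvent scl D A z v) \<le> C * pow_norm inner D A b v"
  obtain e where e: "e \<in> E \<mu>" "e \<noteq> 0" using \<mu> by (auto simp: eigenvalues_def)
  let ?w = "scl (1 / (of_real \<mu> + z)) e"
  have w: "?w \<in> E \<mu>" using e(1) by (rule scl_eigenspace)
  have "resolvent scl D A z e = ?w"
    by (rule resolvent_eqI[OF z]) (use w eigenvector(1) shifted_eigenvector[OF w, of z] z[OF \<mu>] in auto)
  then have "pow_norm inner D A a ?w \<le> C * pow_norm inner D A b e"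
    using C pow_eigenvector(1)[OF e(1) \<mu>] by metis
  then have "\<mu> powr a * (norm e / cmod (of_real \<mu> + z)) \<le> C * (\<mu> powr b * norm e)"
    unfolding pow_eigenvector(2)[OF e(1) \<mu>] pow_eigenvector(2)[OF w \<mu>]
    by (simp add: norm_scl norm_divide)
  then have "\<mu> powr a / cmod (of_real \<mu> + z) \<le> C * \<mu> powr b"
    using mult_le_cancel_right_pos[of "norm e" "\<mu> powr a / cmod (of_real \<mu> + z)" "C * \<mu> powr b"] e(2)
    by (simp add: mult_ac)
  then have "\<mu> powr a / cmod (of_real \<mu> + z) / \<mu> powr b \<le> C"
    using eigenvalue_pos[OF \<mu>] by (simp only: pos_divide_le_eq powr_gt_zero)
  then show "\<mu> powr (a - b) / cmod (of_real \<mu> + z) \<le> C"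
    by (simp add: powr_diff mult.commute)
qed

end

section \<open>The optimal shift and the gap condition\<close>

text \<open>For \<open>\<mu> \<ge> hi\<close> the left side grows slower than the line on the right, since \<open>g \<le> 1\<close>.\<close>
lemma powr_le_distance:
  fixes lo hi g \<nu> M \<mu> :: real
  assumes lo: "0 < lo" "lo < hi" and g: "0 \<le> g" "g \<le> 1"
    and M: "M = (lo powr g + hi powr g) / (hi - lo)"
    and eq: "lo powr g = M * (\<nu> - lo)" "hi powr g = M * (hi - \<nu>)"
    and \<mu>: "0 < \<mu>" "\<mu> \<le> lo \<or> hi \<le> \<mu>"
  shows "\<mu> powr g \<le> M * \<bar>\<mu> - \<nu>\<bar>"
proof -
  have M0: "M > 0" unfolding M using lo by (intro divide_pos_pos add_pos_pos) auto
  consider "\<mu> \<le> lo" | "hi \<le> \<mu>" using \<mu>(2) by blast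
  then show ?thesis
  proof cases
    case 1
    then have "\<mu> powr g \<le> lo powr g" using \<mu>(1) g(1) by (intro powr_mono2) auto
    also have "\<dots> \<le> M * (\<nu> - \<mu>)" unfolding eq using M0 1 by simp
    also have "\<dots> \<le> M * \<bar>\<mu> - \<nu>\<bar>" using M0 by (intro mult_left_mono) auto
    finally show ?thesis .
  next
    case 2
    have "\<mu> powr g = hi powr g * (\<mu> / hi) powr g"
      using lo \<mu>(1) by (simp add: powr_divide)
    also have "\<dots> \<le> hi powr g * (\<mu> / hi) powr 1"
      using lo 2 g(2) by (intro mult_left_mono powr_mono) auto
    also have "\<dots> = hi powr g + hi powr g / hi * (\<mu> - hi)"
      using lo \<mu>(1) by (simp add: field_simps)
    also have "\<dots> \<le> hi powr g + M * (\<mu> - hi)"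
    proof (intro add_left_mono mult_right_mono)
      have "hi powr g / hi \<le> hi powr g / (hi - lo)"
        using lo by (intro divide_left_mono) auto
      also have "\<dots> \<le> M" unfolding M using lo by (intro divide_right_mono) auto
      finally show "hi powr g / hi \<le> M" .
    qed (use 2 in auto)
    also have "\<dots> = M * (\<mu> - \<nu>)" unfolding eq by (simp add: algebra_simps)
    also have "\<dots> \<le> M * \<bar>\<mu> - \<nu>\<bar>" using M0 by (intro mult_left_mono) auto
    finally show ?thesis .
  qed
qed

context complex_positive_discrete_operator
begin

text \<open>Formulated for two adjacent points \<open>lo\<close> and \<open>hi\<close> of the
  spectrum, so that it applies unchanged to a complex operator and to a complexification. The norm
  at \<open>\<nu>\<^sub>0\<close> is at most \<open>M\<close> for every \<open>\<omega>\<close> and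
  reaches \<open>M\<close> at \<open>\<omega> = 0\<close>.\<close>

theorem frequency_condition:
  fixes \<alpha> \<beta> \<Lambda> lo hi \<nu>\<^sub>0 :: real
  assumes \<alpha>\<beta>: "0 \<le> \<beta>" "\<beta> \<le> \<alpha>" "\<alpha> < 1" and \<Lambda>: "\<Lambda> > 0"
    and eig: "lo \<in> \<sigma>" "hi \<in> \<sigma>" "lo < hi" "\<And>\<mu>. \<mu> \<in> \<sigma> \<Longrightarrow> \<mu> \<le> lo \<or> hi \<le> \<mu>"
    and \<nu>\<^sub>0: "\<nu>\<^sub>0 = hi powr (\<alpha> - \<beta>) / (lo powr (\<alpha> - \<beta>) + hi powr (\<alpha> - \<beta>)) * lo
            + lo powr (\<alpha> - \<beta>) / (lo powr (\<alpha> - \<beta>) + hi powr (\<alpha> - \<beta>)) * hi"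
  shows "\<nu>\<^sub>0 \<in> {lo <..< hi} \<and>
    (\<forall>\<nu>\<in>{lo <..< hi}.
       (SUP \<omega>::real. resolvent_norm scl ip D A \<beta> \<alpha>
          (- complex_of_real \<nu>\<^sub>0 + \<i> * complex_of_real \<omega>))
       \<le> (SUP \<omega>::real. resolvent_norm scl ip D A \<beta> \<alpha>
            (- complex_of_real \<nu> + \<i> * complex_of_real \<omega>))) \<and>
    ((\<forall>\<omega>::real. resolvent_norm scl ip D A \<beta> \<alpha>
         (- complex_of_real \<nu>\<^sub>0 + \<i> * complex_of_real \<omega>) < ennreal (inverse \<Lambda>))
     \<longleftrightarrow> (hi - lo) / (lo powr (\<alpha> - \<beta>) + hi powr (\<alpha> - \<beta>)) > \<Lambda>)"
proof -
  define g where "g = \<alpha> - \<beta>"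
  define p where "p = lo powr g"
  define q where "q = hi powr g"
  define M where "M = (p + q) / (hi - lo)"
  define N where "N \<nu> \<omega> = resolvent_norm scl ip D A \<beta> \<alpha> (- complex_of_real \<nu> + \<i> * complex_of_real \<omega>)"
    for \<nu> \<omega>
  have lo0: "lo > 0" and hi0: "hi > 0" using eig eigenvalue_pos by auto
  have p0: "p > 0" and q0: "q > 0" using lo0 hi0 by (auto simp: p_def q_def)
  have M0: "M > 0" unfolding M_def using p0 q0 eig(3) by simp
  have \<nu>\<^sub>0': "\<nu>\<^sub>0 = q / (p + q) * lo + p / (p + q) * hi"
    unfolding \<nu>\<^sub>0 p_def q_def g_def ..
  have pq: "p + q > 0" using p0 q0 by simp
  have "\<nu>\<^sub>0 * (p + q) = q * lo + p * hi"
    unfolding \<nu>\<^sub>0' using pq by (simp add: distrib_right)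
  \<comment> \<open>The point \<open>\<nu>\<^sub>0\<close> divides the interval in the ratio
    \<open>p : q\<close>, which is what makes the multipliers at \<open>lo\<close> and
    \<open>hi\<close> equal.\<close>
  then have "p * (hi - lo) = (p + q) * (\<nu>\<^sub>0 - lo)" "q * (hi - lo) = (p + q) * (hi - \<nu>\<^sub>0)"
    by (simp_all add: algebra_simps)
  then have p_eq: "p = M * (\<nu>\<^sub>0 - lo)" and q_eq: "q = M * (hi - \<nu>\<^sub>0)"
    unfolding M_def using eig(3) by (simp_all add: eq_divide_eq)
  have \<nu>\<^sub>0_in: "\<nu>\<^sub>0 \<in> {lo <..< hi}"
    using p0 q0 M0 unfolding p_eq q_eq by (simp add: zero_less_mult_iff)
  have Re_le: "\<bar>\<mu> - \<nu>\<bar> \<le> cmod (of_real \<mu> + (- complex_of_real \<nu> + \<i> * complex_of_real \<omega>))" for \<mu> \<nu> \<omega>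
    using abs_Re_le_cmod[of "of_real \<mu> + (- complex_of_real \<nu> + \<i> * complex_of_real \<omega>)"] by simp
  have upper: "N \<nu>\<^sub>0 \<omega> \<le> ennreal M" for \<omega>
    unfolding N_def
  \<comment> \<open>No eigenvalue lies strictly between \<open>lo\<close> and \<open>hi\<close>, so
    this \<open>c\<close> is the distance from \<open>\<nu>\<^sub>0\<close> to the spectrum.\<close>
  proof (rule resolvent_norm_le[where c = "min (\<nu>\<^sub>0 - lo) (hi - \<nu>\<^sub>0)"])
    fix \<mu> assume \<mu>: "\<mu> \<in> \<sigma>"
    have "min (\<nu>\<^sub>0 - lo) (hi - \<nu>\<^sub>0) \<le> \<bar>\<mu> - \<nu>\<^sub>0\<bar>"
      using eig(4)[OF \<mu>] \<nu>\<^sub>0_in by auto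
    then show "min (\<nu>\<^sub>0 - lo) (hi - \<nu>\<^sub>0)
        \<le> cmod (of_real \<mu> + (- complex_of_real \<nu>\<^sub>0 + \<i> * complex_of_real \<omega>))"
      using Re_le order_trans by blast
    have "\<mu> powr g \<le> M * \<bar>\<mu> - \<nu>\<^sub>0\<bar>"
      by (rule powr_le_distance[OF lo0 eig(3) _ _ M_def[unfolded p_def q_def]])
         (use \<alpha>\<beta> p_eq q_eq eigenvalue_pos[OF \<mu>] eig(4)[OF \<mu>] in \<open>auto simp: g_def p_def q_def\<close>)
    also have "\<dots> \<le> M * cmod (of_real \<mu> + (- complex_of_real \<nu>\<^sub>0 + \<i> * complex_of_real \<omega>))"
      using M0 Re_le by (intro mult_left_mono) auto
    finally show "\<mu> powr (\<alpha> - \<beta>)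
        \<le> M * cmod (of_real \<mu> + (- complex_of_real \<nu>\<^sub>0 + \<i> * complex_of_real \<omega>))"
      by (simp add: g_def)
  qed (use \<nu>\<^sub>0_in M0 in auto)
  have lower: "ennreal M \<le> N \<nu> 0" if \<nu>: "\<nu> \<in> {lo <..< hi}" for \<nu>
  proof -
    have ne: "of_real \<mu> + (- complex_of_real \<nu> + \<i> * complex_of_real 0) \<noteq> 0" if "\<mu> \<in> \<sigma>" for \<mu>
      using Re_le[of \<mu> \<nu> 0] eig(4)[OF that] \<nu> by fastforce
    have ge: "ennreal (\<mu> powr g / \<bar>\<mu> - \<nu>\<bar>) \<le> N \<nu> 0" if "\<mu> \<in> \<sigma>" for \<mu>
    proof -
      have "cmod (of_real \<mu> + (- complex_of_real \<nu> + \<i> * complex_of_real 0)) = \<bar>\<mu> - \<nu>\<bar>"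
        by (simp flip: of_real_diff of_real_minus of_real_add)
      then show ?thesis
        using resolvent_norm_ge[OF ne that, where a = \<alpha> and b = \<beta>] by (simp add: N_def g_def)
    qed
    \<comment> \<open>If both multipliers were below \<open>M\<close>, adding the two inequalities
      would eliminate \<open>\<nu>\<close> and give \<open>p + q < M * (hi - lo)\<close>, against
      the choice of \<open>M\<close>.\<close>
    have "M \<le> p / \<bar>lo - \<nu>\<bar> \<or> M \<le> q / \<bar>hi - \<nu>\<bar>"
    proof (rule ccontr)
      assume "\<not> ?thesis"
      then have "p < M * (\<nu> - lo)" "q < M * (hi - \<nu>)"
        using \<nu> by (auto simp: not_le divide_less_eq)
      then have "p + q < M * (hi - lo)" by (simp add: algebra_simps)
      then show False using eig(3) by (simp add: M_def)
    qed
    then obtain \<mu> where "\<mu> \<in> \<sigma>" "M \<le> \<mu> powr g / \<bar>\<mu> - \<nu>\<bar>"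
      using eig(1,2) unfolding p_def q_def by blast
    then show ?thesis
      using ge order_trans ennreal_leI by meson
  qed
  have "(SUP \<omega>. N \<nu>\<^sub>0 \<omega>) \<le> (SUP \<omega>. N \<nu> \<omega>)" if "\<nu> \<in> {lo <..< hi}" for \<nu>
  proof -
    have "(SUP \<omega>. N \<nu>\<^sub>0 \<omega>) \<le> ennreal M" by (rule SUP_least) (rule upper)
    also have "\<dots> \<le> N \<nu> 0" by (rule lower[OF that])
    also have "\<dots> \<le> (SUP \<omega>. N \<nu> \<omega>)" by (rule SUP_upper) simp
    finally show ?thesis .
  qed
  \<comment> \<open>The bound \<open>M\<close> is attained at \<open>\<omega> = 0\<close>, so the
    strict inequality for all \<open>\<omega>\<close> is equivalent to a strict inequality for
    \<open>M\<close>.\<close>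
  moreover have "(\<forall>\<omega>. N \<nu>\<^sub>0 \<omega> < ennreal (inverse \<Lambda>)) \<longleftrightarrow> M < inverse \<Lambda>"
  proof
    assume "\<forall>\<omega>. N \<nu>\<^sub>0 \<omega> < ennreal (inverse \<Lambda>)"
    then have "ennreal M < ennreal (inverse \<Lambda>)"
      using lower[OF \<nu>\<^sub>0_in] le_less_trans by blast
    then show "M < inverse \<Lambda>" using M0 by (simp add: ennreal_less_iff)
  next
    assume "M < inverse \<Lambda>"
    then have "ennreal M < ennreal (inverse \<Lambda>)" using M0 by (simp add: ennreal_less_iff)
    then show "\<forall>\<omega>. N \<nu>\<^sub>0 \<omega> < ennreal (inverse \<Lambda>)" using upper le_less_trans by blast
  qed
  moreover have "M < inverse \<Lambda> \<longleftrightarrow> (hi - lo) / (p + q) > \<Lambda>"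
    unfolding M_def using \<Lambda> pq eig(3) by (simp add: field_simps)
  ultimately show ?thesis
    using \<nu>\<^sub>0_in unfolding N_def p_def q_def g_def by blast
qed

end

section \<open>From the enumeration to the set of eigenvalues\<close>

text \<open>A value is listed exactly when its multiplicity is positive. Finite dimension matters
  here: an infinite basis has \<open>card\<close> 0, so \<open>dim\<close> would not tell such an
  eigenspace from the zero space.\<close>

lemma eigenvalue_enumeration_image:
  fixes scl :: "'k::field \<Rightarrow> 'a::real_inner \<Rightarrow> 'a"
  assumes "vector_space scl" and enum: "eigenvalue_enumeration scl D A I lam"
    and fin: "\<And>\<mu>. \<exists>B. finite B \<and> eigenspace D A \<mu> \<subseteq> module.span scl B"
  shows "eigenvalues D A = lam ` I"
proof -
  interpret vector_space scl by fact
  have dim_pos: "0 < dim V \<longleftrightarrow> (\<exists>u\<in>V. u \<noteq> 0)" if V: "finite C" "V \<subseteq> span C" for V C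
  proof -
    obtain B where B: "B \<subseteq> V" "independent B" "V \<subseteq> span B" "card B = dim V"
      by (rule basis_exists)
    have "finite B" using independent_span_bound[of C B] V B by auto
    moreover have "B \<noteq> {} \<longleftrightarrow> (\<exists>u\<in>V. u \<noteq> 0)"
    proof
      assume "B \<noteq> {}"
      then obtain b where "b \<in> B" by blast
      with B show "\<exists>u\<in>V. u \<noteq> 0" using dependent_zero[of B] by (metis subsetD)
    qed (use B in auto)
    ultimately show ?thesis using B(4) by (metis card_gt_0_iff)
  qed
  have "\<mu> \<in> eigenvalues D A \<longleftrightarrow> {n\<in>I. lam n = \<mu>} \<noteq> {}" for \<mu>
  proof -
    obtain B where "finite B" "eigenspace D A \<mu> \<subseteq> span B" using fin by blast
    then have "\<mu> \<in> eigenvalues D A \<longleftrightarrow> 0 < dim (eigenspace D A \<mu>)"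
      using dim_pos[of B] by (simp add: eigenvalues_def)
    also have "\<dots> \<longleftrightarrow> 0 < card {n\<in>I. lam n = \<mu>}"
      using enum by (simp add: eigenvalue_enumeration_def)
    also have "\<dots> \<longleftrightarrow> {n\<in>I. lam n = \<mu>} \<noteq> {}"
      using enum unfolding eigenvalue_enumeration_def card_gt_0_iff by blast
    finally show ?thesis .
  qed
  then show ?thesis by auto
qed

text \<open>The index set is an initial segment of the positive integers, so it contains
  \<open>j\<close>; monotonicity then sends indices up to \<open>j\<close> below
  \<open>lam j\<close> and later ones above \<open>lam (j + 1)\<close>.\<close>

lemma enumeration_consecutive:
  assumes enum: "eigenvalue_enumeration scl D A I lam" and j: "j \<ge> 1" "j + 1 \<in> I"
  shows "lam j \<in> lam ` I" "lam (j + 1) \<in> lam ` I"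
    "\<And>\<mu>. \<mu> \<in> lam ` I \<Longrightarrow> \<mu> \<le> lam j \<or> lam (j + 1) \<le> \<mu>"
proof -
  have jI: "j \<in> I" using enum j by (auto simp: eigenvalue_enumeration_def)
  have mono: "mono_on I lam" using enum by (simp add: eigenvalue_enumeration_def)
  show "lam j \<in> lam ` I" "lam (j + 1) \<in> lam ` I" using jI j by auto
  fix \<mu> assume "\<mu> \<in> lam ` I"
  then obtain n where n: "n \<in> I" "\<mu> = lam n" by auto
  show "\<mu> \<le> lam j \<or> lam (j + 1) \<le> \<mu>"
    using mono_onD[OF mono n(1) jI] mono_onD[OF mono j(2) n(1)] n(2) by (cases "n \<le> j") auto
qed

text \<open>A complex span is also a real subspace, so it contains the real span of the same finite
  set.\<close>

lemma (in complex_positive_discrete_operator) eigenspace_complex_span: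
  "\<exists>B. finite B \<and> E \<mu> \<subseteq> span B"
proof -
  obtain B where B: "finite B" "B \<subseteq> E \<mu>" "E \<mu> = real_vector.span B"
    by (rule eigenspace_finitely_spanned)
  have "real_vector.subspace (span B)"
    unfolding real_vector.subspace_def
    using span_zero span_add span_scale by (auto simp flip: scale_of_real)
  then have "real_vector.span B \<subseteq> span B"
    by (rule real_vector.span_minimal[OF span_superset])
  with B show ?thesis by auto
qed

section \<open>Complexification of a real operator\<close>

context positive_discrete_operator
begin

text \<open>The inverse acts componentwise, so it maps a bounded set into a product of two compact
  sets.\<close>

lemma complexification_compact_inverse:
  "compact_inverse_op (D \<times> D) (map_prod A A)"
proof -
  let ?K = "the_inv_into D A"
  have inj: "inj_on (map_prod A A) (D \<times> D)"
    using A_bij by (auto simp: bij_betw_def intro: map_prod_inj_on)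
  have bij: "bij_betw (map_prod A A) (D \<times> D) UNIV"
    unfolding bij_betw_def using inj A_bij by (auto simp: bij_betw_def map_prod_surj_on)
  have inv: "the_inv_into (D \<times> D) (map_prod A A) = map_prod ?K ?K"
    by (rule ext, rule the_inv_into_f_eq[OF inj]) (auto simp: A_inverse inverse_in_D)
  have "compact (closure (map_prod ?K ?K ` S))" if S: "bounded S" for S
  proof -
    let ?T = "closure (?K ` fst ` S) \<times> closure (?K ` snd ` S)"
    have T: "compact ?T"
      using S by (intro compact_Times inverse_compact bounded_fst bounded_snd)
    have "map_prod ?K ?K ` S \<subseteq> (?K ` fst ` S) \<times> (?K ` snd ` S)"
      by force
    also have "\<dots> \<subseteq> ?T"
      by (intro Sigma_mono closure_subset)
    finally have "map_prod ?K ?K ` S \<subseteq> ?T" .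
    then have "closure (map_prod ?K ?K ` S) \<subseteq> ?T"
      using T by (intro closure_minimal compact_imp_closed)
    from compact_Int_closed[OF T closed_closure, of "map_prod ?K ?K ` S"] this show ?thesis
      by (simp add: inf.absorb2)
  qed
  with bij inv show ?thesis by (simp add: compact_inverse_op_def)
qed

text \<open>The inner product on pairs is the real part of \<open>cplx_inner\<close>, so
  self-adjointness and positivity can be checked in real terms, component by component.\<close>

lemma complexification:
  "complex_positive_discrete_operator (D \<times> D) (map_prod A A) cplx_scale cplx_inner"
proof -
  interpret cplx: complex_inner_product cplx_scale cplx_inner
    by (rule complex_inner_product_complexification)
  have sub: "cplx.subspace (D \<times> D)"
    unfolding cplx.subspace_def using subspace_D
    by (auto simp: cplx_scale_def real_vector.subspace_0 zero_prod_def
        intro!: real_vector.subspace_add real_vector.subspace_diff real_vector.subspace_scale)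
  have A_diff: "A (u - v) = A u - A v" if "u \<in> D" "v \<in> D" for u v
  proof -
    have "A (u + (-1) *\<^sub>R v) = A u + (-1) *\<^sub>R A v"
      using that subspace_D by (simp only: A_add A_scale real_vector.subspace_scale)
    then show ?thesis by simp
  qed
  have lin: "linear_op cplx_scale (D \<times> D) (map_prod A A)"
    using sub subspace_D
    by (auto simp: linear_op_def cplx_scale_def A_add A_scale A_diff real_vector.subspace_scale)
  have graph: "adjoint_graph inner (D \<times> D) (map_prod A A) = {(u, map_prod A A u) | u. u \<in> D \<times> D}"
  proof -
    have "x \<in> D \<times> D \<and> y = map_prod A A x"
      if xy: "\<And>u. u \<in> D \<times> D \<Longrightarrow> inner (map_prod A A u) x = inner u y" for x y
    proof -
      \<comment> \<open>The test pairs \<open>(u, 0)\<close> and \<open>(0, u)\<close> separate the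
        adjoint equation into its two components.\<close>
      have "inner (A u) (fst x) = inner u (fst y)" "inner (A u) (snd x) = inner u (snd y)"
        if "u \<in> D" for u
        using xy[of "(u, 0)"] xy[of "(0, u)"] that real_vector.subspace_0[OF subspace_D]
        by (auto simp: A_0 inner_prod_def)
      then have "fst x \<in> D" "A (fst x) = fst y" "snd x \<in> D" "A (snd x) = snd y"
        using A_maximal by blast+
      then show ?thesis by (auto simp: mem_Times_iff prod_eq_iff)
    qed
    moreover have "inner (map_prod A A u) x = inner u (map_prod A A x)"
      if "u \<in> D \<times> D" "x \<in> D \<times> D" for u x
      using that by (auto simp: A_symmetric inner_prod_def)
    ultimately show ?thesis
      unfolding adjoint_graph_def by blast
  qed
  have pos: "positive_definite_op (D \<times> D) (map_prod A A)"
  proof -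
    have strict: "inner (A u) u > 0" if "u \<in> D" "u \<noteq> 0" for u
      using positive that by (simp add: positive_definite_op_def)
    have nonneg: "inner (A u) u \<ge> 0" if "u \<in> D" for u
      using strict[OF that] by (cases "u = 0") (simp_all add: less_imp_le)
    have "inner (map_prod A A w) w > 0" if w: "w \<in> D \<times> D" "w \<noteq> 0" for w
    proof -
      obtain u v where uv: "w = (u, v)" "u \<in> D" "v \<in> D" "u \<noteq> 0 \<or> v \<noteq> 0"
        using w by (auto simp: zero_prod_def)
      then show ?thesis
        using strict[of u] strict[of v] nonneg[of u] nonneg[of v]
        by (auto simp: inner_prod_def intro: add_pos_nonneg add_nonneg_pos)
    qed
    then show ?thesis by (simp add: positive_definite_op_def)
  qed
  show ?thesis
    by unfold_locales (use lin graph pos complexification_compact_inverse cplx.linear_op_scaleR in auto)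
qed

text \<open>The eigenspace on pairs is \<open>E \<mu> \<times> E \<mu>\<close>, which is nonzero
  exactly when \<open>E \<mu>\<close> is.\<close>

lemma eigenvalues_complexification: "eigenvalues (D \<times> D) (map_prod A A) = eigenvalues D A"
proof -
  have "(u, v) \<in> eigenspace (D \<times> D) (map_prod A A) \<mu> \<longleftrightarrow> u \<in> E \<mu> \<and> v \<in> E \<mu>" for u v \<mu>
    by (auto simp: eigenspace_def)
  moreover have "0 \<in> E \<mu>" for \<mu>
    by (rule real_vector.subspace_0[OF subspace_eigenspace])
  ultimately show ?thesis
    by (force simp: eigenvalues_def zero_prod_def Bex_def)
qed

end

section \<open>The complex and the real case\<close>

theorem mainTheorem6:
  fixes scl :: "complex \<Rightarrow> 'h::{real_inner,complete_space} \<Rightarrow> 'h"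
    and ip :: "'h \<Rightarrow> 'h \<Rightarrow> complex"
    and D :: "'h set" and A :: "'h \<Rightarrow> 'h"
    and DR :: "'r::{real_inner,complete_space} set" and AR :: "'r \<Rightarrow> 'r"
    and I :: "nat set" and lam :: "nat \<Rightarrow> real"
    and \<alpha> \<beta> \<Lambda> \<nu>\<^sub>0 :: real and j :: nat
  assumes "0 \<le> \<beta>" "\<beta> \<le> \<alpha>" "\<alpha> < 1" "\<Lambda> > 0"
    and "j \<ge> 1" "j + 1 \<in> I" "lam (j + 1) - lam j > 0"
    and "\<nu>\<^sub>0 = lam (j + 1) powr (\<alpha> - \<beta>) / (lam j powr (\<alpha> - \<beta>) + lam (j + 1) powr (\<alpha> - \<beta>)) * lam j
            + lam j powr (\<alpha> - \<beta>) / (lam j powr (\<alpha> - \<beta>) + lam (j + 1) powr (\<alpha> - \<beta>)) * lam (j + 1)"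
  shows
    \<comment> \<open>complex Hilbert space\<close>
    "(complex_inner_product scl ip \<and> self_adjoint_op scl ip D A \<and> positive_definite_op D A \<and>
      compact_inverse_op D A \<and> eigenvalue_enumeration scl D A I lam \<longrightarrow>
        \<nu>\<^sub>0 \<in> {lam j <..< lam (j + 1)} \<and>
        (\<forall>\<nu>\<in>{lam j <..< lam (j + 1)}.
           (SUP \<omega>::real. resolvent_norm scl ip D A \<beta> \<alpha>
              (- complex_of_real \<nu>\<^sub>0 + \<i> * complex_of_real \<omega>))
           \<le> (SUP \<omega>::real. resolvent_norm scl ip D A \<beta> \<alpha>
                (- complex_of_real \<nu> + \<i> * complex_of_real \<omega>))) \<and>
        ((\<forall>\<omega>::real. resolvent_norm scl ip D A \<beta> \<alpha>
             (- complex_of_real \<nu>\<^sub>0 + \<i> * complex_of_real \<omega>) < ennreal (inverse \<Lambda>))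
         \<longleftrightarrow> (lam (j + 1) - lam j) / (lam j powr (\<alpha> - \<beta>) + lam (j + 1) powr (\<alpha> - \<beta>)) > \<Lambda>))
     \<and>
     (self_adjoint_op scaleR inner DR AR \<and> positive_definite_op DR AR \<and>
      compact_inverse_op DR AR \<and> eigenvalue_enumeration scaleR DR AR I lam \<longrightarrow>
        \<nu>\<^sub>0 \<in> {lam j <..< lam (j + 1)} \<and>
        (\<forall>\<nu>\<in>{lam j <..< lam (j + 1)}.
           (SUP \<omega>::real. resolvent_norm cplx_scale cplx_inner (DR \<times> DR) (map_prod AR AR) \<beta> \<alpha>
              (- complex_of_real \<nu>\<^sub>0 + \<i> * complex_of_real \<omega>))
           \<le> (SUP \<omega>::real. resolvent_norm cplx_scale cplx_inner (DR \<times> DR) (map_prod AR AR) \<beta> \<alpha>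
                (- complex_of_real \<nu> + \<i> * complex_of_real \<omega>))) \<and>
        ((\<forall>\<omega>::real. resolvent_norm cplx_scale cplx_inner (DR \<times> DR) (map_prod AR AR) \<beta> \<alpha>
             (- complex_of_real \<nu>\<^sub>0 + \<i> * complex_of_real \<omega>) < ennreal (inverse \<Lambda>))
         \<longleftrightarrow> (lam (j + 1) - lam j) / (lam j powr (\<alpha> - \<beta>) + lam (j + 1) powr (\<alpha> - \<beta>)) > \<Lambda>))"
proof ((rule conjI; rule impI; elim conjE), goal_cases)
  case 1
  interpret complex_inner_product scl ip by fact
  have linear: "linear_op scl D A"
    and graph: "adjoint_graph inner D A = {(u, A u) | u. u \<in> D}"
    using 1(2) adjoint_graph_inner by (auto simp: self_adjoint_op_def)
  interpret complex_positive_discrete_operator D A scl ip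
    by unfold_locales (use 1 linear graph linear_op_scaleR in auto)
  have spectrum: "eigenvalues D A = lam ` I"
    by (rule eigenvalue_enumeration_image[OF vector_space_axioms 1(5) eigenspace_complex_span])
  show ?case
    by (rule frequency_condition)
       (use assms enumeration_consecutive[OF 1(5) assms(5,6)] spectrum in auto)
next
  case 2
  interpret R: positive_discrete_operator DR AR
    by unfold_locales (use 2 in \<open>auto simp: self_adjoint_op_def\<close>)
  interpret C: complex_positive_discrete_operator "DR \<times> DR" "map_prod AR AR" cplx_scale cplx_inner
    by (rule R.complexification)
  have "eigenvalues DR AR = lam ` I"
    by (rule eigenvalue_enumeration_image[OF real_vector.vector_space_axioms 2(4)])
       (metis R.eigenspace_finitely_spanned order_refl span_raw_def)
  \<comment> \<open>The enumeration counts real dimensions of the eigenspaces of \<open>AR\<close>;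
    only the resulting set of eigenvalues is carried over to the complexification.\<close>
  then have spectrum: "eigenvalues (DR \<times> DR) (map_prod AR AR) = lam ` I"
    by (simp add: R.eigenvalues_complexification)
  show ?case
    by (rule C.frequency_condition)
       (use assms enumeration_consecutive[OF 2(4) assms(5,6)] spectrum in auto)
qed

end
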